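(* Let $A$ be a regular weak multiplier Hopf algebra of discrete type, and let $H$ be its (faithful) set of left cointegrals in $A$. Let $\varphi\in A'$ be a non-zero linear functional. Then $\varphi$ is a left integral on $A$ if and only if $(id\otimes\varphi)\Delta(h)\in A_t$ for all $h\in H$.
   Context: All algebras are over $\mathbb{C}$, associative, possibly non-unital, with non-degenerate product. $A$ is idempotent if $A^2=A$; $M(A)$ is the multiplier algebra (identity $1$); $A'$ is the space of all linear functionals on $A$. A coproduct is a homomorphism $\Delta:A\to M(A\otimes A)$ with $\Delta(a)(1\otimes b),(a\otimes 1)\Delta(b)\in A\otimes A$, coassociative: $(a\otimes1\otimes1)(\Delta\otimes id)(\Delta(b)(1\otimes c))=(id\otimes\Delta)((a\otimes1)\Delta(b))(1\otimes1\otimes c)$. Put $T_1(a\otimes b)=\Delta(a)(1\otimes b)$, $T_2(a\otimes b)=(a\otimes1)\Delta(b)$. $\Delta$ is full if the smallest subspaces $V,W\subset A$ with $\Delta(A)(1\otimes A)\subset V\otimes A$ and $(A\otimes1)\Delta(A)\subset A\otimes W$ both equal $A$. A counit is a linear functional $\varepsilon$ with $(\varepsilon\otimes id)(\Delta(a)(1\otimes b))=ab$, $(id\otimes\varepsilon)((c\otimes1)\Delta(a))=ca$. A weak multiplier Hopf algebra is a non-degenerate idempotent algebra $A$ with a full coproduct $\Delta$ and a counit such that: (i) there is an idempotent $E\in M(A\otimes A)$ with $T_1(A\otimes A)=E(A\otimes A)$, $T_2(A\otimes A)=(A\otimes A)E$; (ii) $(id\otimes\Delta)E=(E\otimes1)(1\otimes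 E)=(1\otimes E)(E\otimes1)$; (iii) $\mathrm{Ker}(T_i)=(1-G_i)(A\otimes A)$, $i=1,2$, where $G_1,G_2$ are the linear maps on $A\otimes A$ given by $(G_1\otimes id)(\Delta_{13}(a)(1\otimes b\otimes c))=\Delta_{13}(a)(1\otimes E)(1\otimes b\otimes c)$ and $(id\otimes G_2)((a\otimes b\otimes1)\Delta_{13}(c))=(a\otimes b\otimes1)(E\otimes1)\Delta_{13}(c)$. Here $\Delta$ (and likewise $id\otimes\Delta$) is uniquely extended to multipliers, with $\Delta(1)=E$. With Sweedler notation $\Delta(a)=\sum a_{(1)}\otimes a_{(2)}$, the antipode $S$ is the non-degenerate anti-homomorphism $A\to M(A)$ with $E(a\otimes b)=\sum a_{(1)}\otimes a_{(2)}S(a_{(3)})b$, $(a\otimes b)E=\sum aS(b_{(1)})b_{(2)}\otimes b_{(3)}$, $G_1(a\otimes b)=\sum a_{(1)}\otimes S(a_{(2)})a_{(3)}b$, $G_2(a\otimes b)=\sum ab_{(1)}S(b_{(2)})\otimes b_{(3)}$, $\sum S(a_{(1)})a_{(2)}S(a_{(3)})=S(a)$; it extends to $M(A)$. $A$ is regular if $S$ is bijective from $A$ to $A$; then also $\Delta(a)(b\otimes1),(1\otimes a)\Delta(b)\in A\otimes A$. Put $\varepsilon_t(a)=\sum a_{(1)}S(a_{(2)})$ and $A_t=\{x\in M(A):\Delta(x)=(x\otimes1)E\}$. For $f\in A'$, $(id\otimes f)\Delta(a)\in M(A)$ is the multiplier with $((id\otimes f)\Delta(a))b=(id\otimes f)(\Delta(a)(b\otimes1))$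 and $b((id\otimes f)\Delta(a))=(id\otimes f)((b\otimes1)\Delta(a))$. A left integral is a non-zero $\varphi\in A'$ with $(id\otimes\varphi)\Delta(a)\in A_t$ for all $a\in A$. A left cointegral is a non-zero $h\in M(A)$ with $ah=\varepsilon_t(a)h$ for all $a\in A$. $H$ is the space of left cointegrals in $A$ (together with $0$). The left (right) leg of $\Delta(H)$ is the smallest subspace $V$ (resp. $W$) of $A$ with $\Delta(h)(1\otimes a)\in V\otimes A$ (resp. $(a\otimes1)\Delta(h)\in A\otimes W$) for all $a\in A$, $h\in H$. $H$ is a faithful set of left cointegrals if both legs equal $A$; $A$ is of discrete type if it has a faithful set of left cointegrals. *)

theory Defs
  imports Complex_Main "HOL-Library.Poly_Mapping"
begin

section \<open>Complex vector spaces and non-unital complex algebras\<close>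

class complex_space = ab_group_add +
  fixes scaleC :: "complex \<Rightarrow> 'a \<Rightarrow> 'a"  (infixr \<open>*\<^sub>C\<close> 75)
  assumes scaleC_add_right: "c *\<^sub>C (x + y) = c *\<^sub>C x + c *\<^sub>C y"
    and scaleC_add_left: "(c + d) *\<^sub>C x = c *\<^sub>C x + d *\<^sub>C x"
    and scaleC_scaleC: "c *\<^sub>C d *\<^sub>C x = (c * d) *\<^sub>C x"
    and scaleC_one: "1 *\<^sub>C x = x"

class complex_alg = complex_space + ring +
  assumes mult_scaleC_left: "c *\<^sub>C x * y = c *\<^sub>C (x * y)"
    and mult_scaleC_right: "x * c *\<^sub>C y = c *\<^sub>C (x * y)"

global_interpretation cvec: vector_space "scaleC :: complex \<Rightarrow> 'a \<Rightarrow> 'a::complex_space"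
  by unfold_locales (simp_all add: scaleC_add_right scaleC_add_left scaleC_scaleC scaleC_one)

instantiation complex :: complex_alg
begin
definition scaleC_complex :: "complex \<Rightarrow> complex \<Rightarrow> complex"
  where "scaleC_complex = (*)"
instance by standard (simp_all add: scaleC_complex_def algebra_simps)
end

abbreviation clinear :: "('a::complex_space \<Rightarrow> 'b::complex_space) \<Rightarrow> bool"
  where "clinear \<equiv> Vector_Spaces.linear scaleC scaleC"

lemma clinear_iff: "clinear f \<longleftrightarrow> (\<forall>x y. f (x + y) = f x + f y) \<and> (\<forall>c x. f (c *\<^sub>C x) = c *\<^sub>C f x)"
proof -
  have "module_hom scaleC scaleC f \<longleftrightarrow> (\<forall>x y. f (x + y) = f x + f y) \<and> (\<forall>c x. f (c *\<^sub>C x) = c *\<^sub>C f x)"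
    by (simp add: module_hom_iff cvec.module_axioms)
  then show ?thesis
    by (simp add: Vector_Spaces.linear_def module_hom_iff cvec.vector_space_axioms)
qed

definition cbilinear :: "('a::complex_space \<Rightarrow> 'b::complex_space \<Rightarrow> 'c::complex_space) \<Rightarrow> bool"
  where "cbilinear \<beta> \<longleftrightarrow> (\<forall>b. clinear (\<lambda>a. \<beta> a b)) \<and> (\<forall>a. clinear (\<beta> a))"

lemma cbilinear_iff: "cbilinear \<beta> \<longleftrightarrow>
    (\<forall>a a' b. \<beta> (a + a') b = \<beta> a b + \<beta> a' b) \<and> (\<forall>c a b. \<beta> (c *\<^sub>C a) b = c *\<^sub>C \<beta> a b) \<and>
    (\<forall>a b b'. \<beta> a (b + b') = \<beta> a b + \<beta> a b') \<and> (\<forall>c a b. \<beta> a (c *\<^sub>C b) = c *\<^sub>C \<beta> a b)"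
  unfolding cbilinear_def clinear_iff by blast

section \<open>Algebraic tensor products\<close>

instantiation poly_mapping :: (type, complex_space) complex_space
begin
lift_definition scaleC_poly_mapping :: "complex \<Rightarrow> ('a \<Rightarrow>\<^sub>0 'b) \<Rightarrow> ('a \<Rightarrow>\<^sub>0 'b)"
  is "\<lambda>c f k. c *\<^sub>C f k"
  by (erule rev_finite_subset) auto
instance
  by (standard; transfer) (simp_all add: fun_eq_iff scaleC_add_right scaleC_add_left scaleC_scaleC scaleC_one)
end

lemma lookup_scaleC: "Poly_Mapping.lookup (c *\<^sub>C p) k = c *\<^sub>C Poly_Mapping.lookup p k"
  by transfer simp

text \<open>The tensor product is the free vector space on pairs modulo the bilinearity relations.\<close>

definition tensor_relations :: "(('a::complex_space \<times> 'b::complex_space) \<Rightarrow>\<^sub>0 complex) set"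
  where "tensor_relations =
    {Poly_Mapping.single (a + a', b) 1 - Poly_Mapping.single (a, b) 1 - Poly_Mapping.single (a', b) 1 | a a' b. True} \<union>
    {Poly_Mapping.single (a, b + b') 1 - Poly_Mapping.single (a, b) 1 - Poly_Mapping.single (a, b') 1 | a b b'. True} \<union>
    {Poly_Mapping.single (c *\<^sub>C a, b) 1 - c *\<^sub>C Poly_Mapping.single (a, b) 1 | c a b. True} \<union>
    {Poly_Mapping.single (a, c *\<^sub>C b) 1 - c *\<^sub>C Poly_Mapping.single (a, b) 1 | c a b. True}"

definition tensor_eq :: "(('a::complex_space \<times> 'b::complex_space) \<Rightarrow>\<^sub>0 complex) \<Rightarrow> (('a \<times> 'b) \<Rightarrow>\<^sub>0 complex) \<Rightarrow> bool"
  where "tensor_eq p q \<longleftrightarrow> p - q \<in> cvec.span tensor_relations"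

lemma equivp_tensor_eq: "equivp tensor_eq"
proof (rule equivpI)
  show "reflp tensor_eq"
    by (simp add: reflp_def tensor_eq_def cvec.span_zero)
  show "symp tensor_eq"
    unfolding symp_def tensor_eq_def using cvec.span_neg by fastforce
  show "transp tensor_eq"
    unfolding transp_def tensor_eq_def using cvec.span_add by fastforce
qed

quotient_type (overloaded) ('a, 'b) tensor (infixr \<open>\<otimes>\<close> 75) =
  "('a::complex_space \<times> 'b::complex_space) \<Rightarrow>\<^sub>0 complex" / tensor_eq
  by (rule equivp_tensor_eq)

instantiation tensor :: (complex_space, complex_space) complex_space
begin
lift_definition zero_tensor :: "('a, 'b) tensor" is 0 .
lift_definition plus_tensor :: "('a, 'b) tensor \<Rightarrow> ('a, 'b) tensor \<Rightarrow> ('a, 'b) tensor" is "(+)"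
  unfolding tensor_eq_def by (simp add: add_diff_add cvec.span_add)
lift_definition minus_tensor :: "('a, 'b) tensor \<Rightarrow> ('a, 'b) tensor \<Rightarrow> ('a, 'b) tensor" is "(-)"
  unfolding tensor_eq_def by (drule (1) cvec.span_diff) (simp add: algebra_simps)
lift_definition uminus_tensor :: "('a, 'b) tensor \<Rightarrow> ('a, 'b) tensor" is uminus
  unfolding tensor_eq_def by (drule cvec.span_neg) simp
lift_definition scaleC_tensor :: "complex \<Rightarrow> ('a, 'b) tensor \<Rightarrow> ('a, 'b) tensor" is scaleC
  unfolding tensor_eq_def by (simp add: cvec.scale_right_diff_distrib[symmetric] cvec.span_scale)
instance
  by (standard; transfer)
    (simp_all add: tensor_eq_def cvec.span_zero scaleC_add_right scaleC_add_left scaleC_scaleC scaleC_one algebra_simps)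
end

lift_definition tensor :: "'a::complex_space \<Rightarrow> 'b::complex_space \<Rightarrow> 'a \<otimes> 'b"  (infixr \<open>\<otimes>\<^sub>t\<close> 75)
  is "\<lambda>a b. Poly_Mapping.single (a, b) 1" .

lemma cbilinear_tensor: "cbilinear (\<otimes>\<^sub>t)"
  unfolding cbilinear_iff
proof (intro conjI allI; transfer)
  fix a a' :: 'a and b :: 'b
  show "tensor_eq (Poly_Mapping.single (a + a', b) 1) (Poly_Mapping.single (a, b) 1 + Poly_Mapping.single (a', b) 1)"
    unfolding tensor_eq_def diff_diff_add[symmetric]
    by (rule cvec.span_base) (unfold tensor_relations_def, blast)
next
  fix a :: 'a and b b' :: 'b
  show "tensor_eq (Poly_Mapping.single (a, b + b') 1) (Poly_Mapping.single (a, b) 1 + Poly_Mapping.single (a, b') 1)"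
    unfolding tensor_eq_def diff_diff_add[symmetric]
    by (rule cvec.span_base) (unfold tensor_relations_def, blast)
next
  fix c :: complex and a :: 'a and b :: 'b
  show "tensor_eq (Poly_Mapping.single (c *\<^sub>C a, b) 1) (c *\<^sub>C Poly_Mapping.single (a, b) 1)"
    unfolding tensor_eq_def by (rule cvec.span_base) (unfold tensor_relations_def, blast)
next
  fix c :: complex and a :: 'a and b :: 'b
  show "tensor_eq (Poly_Mapping.single (a, c *\<^sub>C b) 1) (c *\<^sub>C Poly_Mapping.single (a, b) 1)"
    unfolding tensor_eq_def by (rule cvec.span_base) (unfold tensor_relations_def, blast)
qed

lemmas tensor_simps = cbilinear_tensor[unfolded cbilinear_iff, rule_format]

definition lincomb :: "('k \<Rightarrow> 'c::complex_space) \<Rightarrow> ('k \<Rightarrow>\<^sub>0 complex) \<Rightarrow> 'c"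
  where "lincomb \<beta> p = (\<Sum>k\<in>Poly_Mapping.keys p. Poly_Mapping.lookup p k *\<^sub>C \<beta> k)"

lemma lincomb_superset:
  "finite K \<Longrightarrow> Poly_Mapping.keys p \<subseteq> K \<Longrightarrow> lincomb \<beta> p = (\<Sum>k\<in>K. Poly_Mapping.lookup p k *\<^sub>C \<beta> k)"
  unfolding lincomb_def by (rule sum.mono_neutral_left) (auto simp: in_keys_iff)

lemma lincomb_add: "lincomb \<beta> (p + q) = lincomb \<beta> p + lincomb \<beta> q"
proof -
  let ?K = "Poly_Mapping.keys p \<union> Poly_Mapping.keys q"
  have "lincomb \<beta> (p + q) = (\<Sum>k\<in>?K. Poly_Mapping.lookup (p + q) k *\<^sub>C \<beta> k)"
    by (rule lincomb_superset) (auto dest: subsetD[OF keys_add])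
  moreover have "lincomb \<beta> p = (\<Sum>k\<in>?K. Poly_Mapping.lookup p k *\<^sub>C \<beta> k)" "lincomb \<beta> q = (\<Sum>k\<in>?K. Poly_Mapping.lookup q k *\<^sub>C \<beta> k)"
    by (rule lincomb_superset; auto)+
  ultimately show ?thesis
    by (simp add: lookup_add scaleC_add_left sum.distrib)
qed

lemma lincomb_scale: "lincomb \<beta> (c *\<^sub>C p) = c *\<^sub>C lincomb \<beta> p"
proof -
  have "lincomb \<beta> (c *\<^sub>C p) = (\<Sum>k\<in>Poly_Mapping.keys p. Poly_Mapping.lookup (c *\<^sub>C p) k *\<^sub>C \<beta> k)"
    by (rule lincomb_superset) (auto simp: in_keys_iff lookup_scaleC)
  then show ?thesis
    by (simp add: lincomb_def lookup_scaleC cvec.scale_sum_right scaleC_complex_def)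
qed

lemma clinear_lincomb: "clinear (lincomb \<beta>)"
  by (simp add: clinear_iff lincomb_add lincomb_scale)

lemma lincomb_diff: "lincomb \<beta> (p - q) = lincomb \<beta> p - lincomb \<beta> q"
  by (metis add_diff_cancel diff_add_cancel lincomb_add)

lemma lincomb_single: "lincomb \<beta> (Poly_Mapping.single k c) = c *\<^sub>C \<beta> k"
  by (simp add: lincomb_def)

text \<open>
  The linear map on the tensor product induced by a bilinear map. It is meaningful only when
  \<open>\<beta>\<close> is bilinear, since the value is computed on a chosen representative.
\<close>

definition tensor_lift :: "('a::complex_space \<Rightarrow> 'b::complex_space \<Rightarrow> 'c::complex_space) \<Rightarrow> 'a \<otimes> 'b \<Rightarrow> 'c"
  where "tensor_lift \<beta> t = lincomb (\<lambda>(a, b). \<beta> a b) (rep_tensor t)"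

lemma lincomb_tensor_relations:
  assumes "cbilinear \<beta>" and "p \<in> cvec.span tensor_relations"
  shows "lincomb (\<lambda>(a, b). \<beta> a b) p = 0"
  using assms(2)
proof (induction rule: cvec.span_induct)
  case base
  then show ?case
    by (simp add: cvec.subspace_def lincomb_add lincomb_scale)
       (simp add: lincomb_def)
next
  case (step x)
  then show ?case
    using assms(1) unfolding tensor_relations_def cbilinear_iff
    by (auto simp: lincomb_diff lincomb_scale lincomb_single scaleC_one)
qed

lemma tensor_lift_abs:
  assumes "cbilinear \<beta>"
  shows "tensor_lift \<beta> (abs_tensor p) = lincomb (\<lambda>(a, b). \<beta> a b) p"
proof -
  have "tensor_eq (rep_tensor (abs_tensor p)) p"
    by (simp add: tensor.abs_eq_iff[symmetric] Quotient3_abs_rep[OF Quotient3_tensor])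
  then show ?thesis
    using lincomb_tensor_relations[OF assms] unfolding tensor_eq_def tensor_lift_def
    by (metis lincomb_diff eq_iff_diff_eq_0)
qed

lemma tensor_lift_tensor: "cbilinear \<beta> \<Longrightarrow> tensor_lift \<beta> (a \<otimes>\<^sub>t b) = \<beta> a b"
  by (simp add: tensor.abs_eq tensor_lift_abs lincomb_single scaleC_one)

lemma clinear_tensor_lift: "cbilinear \<beta> \<Longrightarrow> clinear (tensor_lift \<beta>)"
proof -
  assume \<beta>: "cbilinear \<beta>"
  have "tensor_lift \<beta> (x + y) = tensor_lift \<beta> x + tensor_lift \<beta> y" for x y
    by (induct x; induct y) (simp add: plus_tensor.abs_eq tensor_lift_abs \<beta> lincomb_add)
  moreover have "tensor_lift \<beta> (c *\<^sub>C x) = c *\<^sub>C tensor_lift \<beta> x" for c x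
    by (induct x) (simp add: scaleC_tensor.abs_eq tensor_lift_abs \<beta> lincomb_scale)
  ultimately show ?thesis by (simp add: clinear_iff)
qed

lemma tensor_induct [case_names tensor add]:
  assumes t: "\<And>a b. P (a \<otimes>\<^sub>t b)" and a: "\<And>x y. P x \<Longrightarrow> P y \<Longrightarrow> P (x + y)"
  shows "P t"
proof (induct t)
  case (1 p)
  have s: "P (abs_tensor (Poly_Mapping.single k c))" for k c
  proof -
    have "abs_tensor (Poly_Mapping.single k c) = c *\<^sub>C (fst k \<otimes>\<^sub>t snd k)"
      unfolding tensor.abs_eq scaleC_tensor.abs_eq
      by (rule arg_cong[of _ _ abs_tensor], rule poly_mapping_eqI)
         (simp add: lookup_scaleC lookup_single when_def scaleC_complex_def)
    also have "\<dots> = (c *\<^sub>C fst k) \<otimes>\<^sub>t snd k" by (simp add: tensor_simps)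
    finally show ?thesis using t by simp
  qed
  show ?case
  proof (induction p rule: update_induct)
    case const
    show ?case using s[of undefined 0] by simp
  next
    case (update f k c)
    then have "Poly_Mapping.update k c f = f + Poly_Mapping.single k c"
      by (intro poly_mapping_eqI) (auto simp: lookup_update lookup_add lookup_single when_def in_keys_iff)
    then show ?case using a[OF update.IH s[of k c]] by (simp add: plus_tensor.abs_eq)
  qed
qed

lemma clinear_tensor_eqI:
  assumes "clinear f" "clinear g" "\<And>a b. f (a \<otimes>\<^sub>t b) = g (a \<otimes>\<^sub>t b)"
  shows "f t = g t"
  using assms by (induction t rule: tensor_induct) (auto simp: clinear_iff)

lemma tensor_lift_add_fun: "tensor_lift (\<lambda>a b. \<beta> a b + \<gamma> a b) t = tensor_lift \<beta> t + tensor_lift \<gamma> t"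
  by (simp add: tensor_lift_def lincomb_def split_beta scaleC_add_right sum.distrib)

lemma tensor_lift_scale_fun: "tensor_lift (\<lambda>a b. c *\<^sub>C \<beta> a b) t = c *\<^sub>C tensor_lift \<beta> t"
  by (simp add: tensor_lift_def lincomb_def split_beta cvec.scale_sum_right mult.commute)

lemma cbilinear_lift_left:
  assumes "\<And>c. cbilinear (\<lambda>a b. F a b c)" "\<And>a b. clinear (F a b)"
  shows "cbilinear (\<lambda>t c. tensor_lift (\<lambda>a b. F a b c) t)"
  using assms(2) clinear_tensor_lift[OF assms(1)] unfolding cbilinear_def clinear_iff
  by (simp add: tensor_lift_add_fun tensor_lift_scale_fun)

lemma cbilinear_lift_right:
  assumes "\<And>a. cbilinear (F a)" "\<And>b c. clinear (\<lambda>a. F a b c)"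
  shows "cbilinear (\<lambda>a. tensor_lift (F a))"
proof -
  have "F (x + y) = (\<lambda>b c. F x b c + F y b c)" "F (r *\<^sub>C x) = (\<lambda>b c. r *\<^sub>C F x b c)" for r x y
    using assms(2) by (auto simp: fun_eq_iff clinear_iff)
  then have "clinear (\<lambda>a. tensor_lift (F a) t)" for t
    by (simp add: clinear_iff tensor_lift_add_fun[of "F _" "F _"] tensor_lift_scale_fun[of _ "F _"])
  with clinear_tensor_lift[OF assms(1)] show ?thesis
    by (simp add: cbilinear_def)
qed

instantiation tensor :: (complex_alg, complex_alg) complex_alg
begin

definition times_tensor :: "'a \<otimes> 'b \<Rightarrow> 'a \<otimes> 'b \<Rightarrow> 'a \<otimes> 'b"
  where "t * u = tensor_lift (\<lambda>a b. tensor_lift (\<lambda>c d. (a * c) \<otimes>\<^sub>t (b * d)) u) t"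

lemma times_tensor_aux1: "cbilinear (\<lambda>c d. (a * c) \<otimes>\<^sub>t (b * d))" for a :: 'a and b :: 'b
  by (simp add: cbilinear_iff tensor_simps distrib_left mult_scaleC_right)

lemma times_tensor_aux2: "cbilinear (\<lambda>a b. tensor_lift (\<lambda>c d. (a * c) \<otimes>\<^sub>t (b * d)) u)" for u :: "'a \<otimes> 'b"
  by (simp add: cbilinear_iff tensor_simps distrib_right mult_scaleC_left
      tensor_lift_add_fun tensor_lift_scale_fun)

lemma cbilinear_times_tensor: "cbilinear ((*) :: 'a \<otimes> 'b \<Rightarrow> _)"
  using clinear_tensor_lift[OF times_tensor_aux1] clinear_tensor_lift[OF times_tensor_aux2]
  unfolding cbilinear_def times_tensor_def
  by (simp add: clinear_iff tensor_lift_add_fun tensor_lift_scale_fun)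

lemmas times_tensor_simps = cbilinear_times_tensor[unfolded cbilinear_iff, rule_format]

lemma tensor_times_tensor: "(a \<otimes>\<^sub>t b) * (c \<otimes>\<^sub>t d) = (a * c) \<otimes>\<^sub>t (b * d)" for a c :: 'a and b d :: 'b
  unfolding times_tensor_def tensor_lift_tensor[OF times_tensor_aux2] by (rule tensor_lift_tensor[OF times_tensor_aux1])

instance
proof
  fix x y z :: "'a \<otimes> 'b" and c :: complex
  show "x * y * z = x * (y * z)"
  proof (induction x rule: tensor_induct)
    case (tensor a b)
    show ?case
    proof (induction y rule: tensor_induct)
      case (tensor a' b')
      show ?case
        by (induction z rule: tensor_induct)
           (simp_all add: tensor_times_tensor times_tensor_simps mult.assoc)
    qed (simp add: times_tensor_simps)
  qed (simp add: times_tensor_simps)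
qed (simp_all add: times_tensor_simps)

end

definition tensor_map :: "('a::complex_space \<Rightarrow> 'c::complex_space) \<Rightarrow> ('b::complex_space \<Rightarrow> 'd::complex_space)
    \<Rightarrow> 'a \<otimes> 'b \<Rightarrow> 'c \<otimes> 'd"
  where "tensor_map f g = tensor_lift (\<lambda>a b. f a \<otimes>\<^sub>t g b)"

lemma
  assumes "clinear f" "clinear g"
  shows clinear_tensor_map: "clinear (tensor_map f g)"
    and tensor_map_tensor: "tensor_map f g (a \<otimes>\<^sub>t b) = f a \<otimes>\<^sub>t g b"
proof -
  have "cbilinear (\<lambda>a b. f a \<otimes>\<^sub>t g b)"
    using assms by (simp add: cbilinear_iff clinear_iff tensor_simps)
  then show "clinear (tensor_map f g)" "tensor_map f g (a \<otimes>\<^sub>t b) = f a \<otimes>\<^sub>t g b"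
    by (simp_all add: tensor_map_def clinear_tensor_lift tensor_lift_tensor)
qed

definition tassoc :: "('a::complex_space \<otimes> 'b::complex_space) \<otimes> 'c::complex_space \<Rightarrow> 'a \<otimes> ('b \<otimes> 'c)"
  where "tassoc = tensor_lift (\<lambda>t c. tensor_lift (\<lambda>a b. a \<otimes>\<^sub>t (b \<otimes>\<^sub>t c)) t)"

definition tassoc' :: "'a::complex_space \<otimes> ('b::complex_space \<otimes> 'c::complex_space) \<Rightarrow> ('a \<otimes> 'b) \<otimes> 'c"
  where "tassoc' = tensor_lift (\<lambda>a. tensor_lift (\<lambda>b c. (a \<otimes>\<^sub>t b) \<otimes>\<^sub>t c))"

definition tflip23 :: "('a::complex_space \<otimes> 'b::complex_space) \<otimes> 'c::complex_space \<Rightarrow> ('a \<otimes> 'c) \<otimes> 'b"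
  where "tflip23 = tensor_lift (\<lambda>t c. tensor_lift (\<lambda>a b. (a \<otimes>\<^sub>t c) \<otimes>\<^sub>t b) t)"

lemma
  fixes a :: "'a::complex_space" and b :: "'b::complex_space" and c :: "'c::complex_space"
  shows clinear_tassoc: "clinear (tassoc :: ('a \<otimes> 'b) \<otimes> 'c \<Rightarrow> _)"
    and tassoc_tensor: "tassoc ((a \<otimes>\<^sub>t b) \<otimes>\<^sub>t c) = a \<otimes>\<^sub>t (b \<otimes>\<^sub>t c)"
proof -
  have 1: "cbilinear (\<lambda>(a::'a) (b::'b). a \<otimes>\<^sub>t (b \<otimes>\<^sub>t c))" for c :: 'c
    by (simp add: cbilinear_iff tensor_simps)
  have 2: "cbilinear (\<lambda>t (c::'c). tensor_lift (\<lambda>(a::'a) (b::'b). a \<otimes>\<^sub>t (b \<otimes>\<^sub>t c)) t)"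
    by (rule cbilinear_lift_left) (simp_all add: cbilinear_iff clinear_iff tensor_simps)
  show "clinear (tassoc :: ('a \<otimes> 'b) \<otimes> 'c \<Rightarrow> _)" unfolding tassoc_def by (rule clinear_tensor_lift[OF 2])
  show "tassoc ((a \<otimes>\<^sub>t b) \<otimes>\<^sub>t c) = a \<otimes>\<^sub>t (b \<otimes>\<^sub>t c)"
    unfolding tassoc_def tensor_lift_tensor[OF 2] by (rule tensor_lift_tensor[OF 1])
qed

lemma
  fixes a :: "'a::complex_space" and b :: "'b::complex_space" and c :: "'c::complex_space"
  shows clinear_tassoc': "clinear (tassoc' :: 'a \<otimes> ('b \<otimes> 'c) \<Rightarrow> _)"
    and tassoc'_tensor: "tassoc' (a \<otimes>\<^sub>t (b \<otimes>\<^sub>t c)) = (a \<otimes>\<^sub>t b) \<otimes>\<^sub>t c"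
proof -
  have 1: "cbilinear (\<lambda>(b::'b) (c::'c). (a \<otimes>\<^sub>t b) \<otimes>\<^sub>t c)" for a :: 'a
    by (simp add: cbilinear_iff tensor_simps)
  have 2: "cbilinear (\<lambda>a::'a. tensor_lift (\<lambda>(b::'b) (c::'c). (a \<otimes>\<^sub>t b) \<otimes>\<^sub>t c))"
    by (rule cbilinear_lift_right) (simp_all add: cbilinear_iff clinear_iff tensor_simps)
  show "clinear (tassoc' :: 'a \<otimes> ('b \<otimes> 'c) \<Rightarrow> _)" unfolding tassoc'_def by (rule clinear_tensor_lift[OF 2])
  show "tassoc' (a \<otimes>\<^sub>t (b \<otimes>\<^sub>t c)) = (a \<otimes>\<^sub>t b) \<otimes>\<^sub>t c"
    unfolding tassoc'_def tensor_lift_tensor[OF 2] by (rule tensor_lift_tensor[OF 1])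
qed

lemma
  fixes a :: "'a::complex_space" and b :: "'b::complex_space" and c :: "'c::complex_space"
  shows clinear_tflip23: "clinear (tflip23 :: ('a \<otimes> 'b) \<otimes> 'c \<Rightarrow> _)"
    and tflip23_tensor: "tflip23 ((a \<otimes>\<^sub>t b) \<otimes>\<^sub>t c) = (a \<otimes>\<^sub>t c) \<otimes>\<^sub>t b"
proof -
  have 1: "cbilinear (\<lambda>(a::'a) (b::'b). (a \<otimes>\<^sub>t c) \<otimes>\<^sub>t b)" for c :: 'c
    by (simp add: cbilinear_iff tensor_simps)
  have 2: "cbilinear (\<lambda>t (c::'c). tensor_lift (\<lambda>(a::'a) (b::'b). (a \<otimes>\<^sub>t c) \<otimes>\<^sub>t b) t)"
    by (rule cbilinear_lift_left) (simp_all add: cbilinear_iff clinear_iff tensor_simps)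
  show "clinear (tflip23 :: ('a \<otimes> 'b) \<otimes> 'c \<Rightarrow> _)" unfolding tflip23_def by (rule clinear_tensor_lift[OF 2])
  show "tflip23 ((a \<otimes>\<^sub>t b) \<otimes>\<^sub>t c) = (a \<otimes>\<^sub>t c) \<otimes>\<^sub>t b"
    unfolding tflip23_def tensor_lift_tensor[OF 2] by (rule tensor_lift_tensor[OF 1])
qed

lemma tensor3_induct [case_names tensor add]:
  fixes t :: "('a::complex_space \<otimes> 'b::complex_space) \<otimes> 'c::complex_space"
  assumes t: "\<And>a b c. P ((a \<otimes>\<^sub>t b) \<otimes>\<^sub>t c)" and a: "\<And>x y. P x \<Longrightarrow> P y \<Longrightarrow> P (x + y)"
  shows "P t"
proof (induction t rule: tensor_induct)
  case (tensor x c)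
  show ?case by (induction x rule: tensor_induct) (simp_all add: t a tensor_simps)
qed (rule a)

lemma tensor3_induct' [case_names tensor add]:
  fixes t :: "'a::complex_space \<otimes> ('b::complex_space \<otimes> 'c::complex_space)"
  assumes t: "\<And>a b c. P (a \<otimes>\<^sub>t (b \<otimes>\<^sub>t c))" and a: "\<And>x y. P x \<Longrightarrow> P y \<Longrightarrow> P (x + y)"
  shows "P t"
proof (induction t rule: tensor_induct)
  case (tensor x c)
  show ?case by (induction c rule: tensor_induct) (simp_all add: t a tensor_simps)
qed (rule a)

lemmas tassoc_add = clinear_tassoc[unfolded clinear_iff, THEN conjunct1, rule_format]
lemmas tassoc'_add = clinear_tassoc'[unfolded clinear_iff, THEN conjunct1, rule_format]
lemmas tflip23_add = clinear_tflip23[unfolded clinear_iff, THEN conjunct1, rule_format]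

lemma tassoc_tassoc' [simp]: "tassoc (tassoc' t) = t"
  by (induction t rule: tensor3_induct') (simp_all add: tassoc_tensor tassoc'_tensor tassoc_add tassoc'_add)

lemma tassoc'_tassoc [simp]: "tassoc' (tassoc t) = t"
  by (induction t rule: tensor3_induct) (simp_all add: tassoc_tensor tassoc'_tensor tassoc_add tassoc'_add)

lemma tflip23_tflip23 [simp]: "tflip23 (tflip23 t) = t"
  by (induction t rule: tensor3_induct) (simp_all add: tflip23_tensor tflip23_add)

lemma tassoc_mult: "tassoc (t * u) = tassoc t * tassoc u"
  for t u :: "('a::complex_alg \<otimes> 'b::complex_alg) \<otimes> 'c::complex_alg"
proof (induction t rule: tensor3_induct)
  case (tensor a b c)
  show ?case
    by (induction u rule: tensor3_induct)
       (simp_all add: tensor_times_tensor tassoc_tensor tassoc_add distrib_left)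
qed (simp add: tassoc_add distrib_right)

lemma tflip23_mult: "tflip23 (t * u) = tflip23 t * tflip23 u"
  for t u :: "('a::complex_alg \<otimes> 'b::complex_alg) \<otimes> 'c::complex_alg"
proof (induction t rule: tensor3_induct)
  case (tensor a b c)
  show ?case
    by (induction u rule: tensor3_induct)
       (simp_all add: tensor_times_tensor tflip23_tensor tflip23_add distrib_left)
qed (simp add: tflip23_add distrib_right)

lemma tassoc'_mult: "tassoc' (t * u) = tassoc' t * tassoc' u"
  for t u :: "'a::complex_alg \<otimes> ('b::complex_alg \<otimes> 'c::complex_alg)"
  by (metis tassoc_mult tassoc_tassoc' tassoc'_tassoc)

section \<open>The multiplier algebra\<close>

text \<open>
  A multiplier is a pair of a left action \<open>L b = m b\<close> and a right action \<open>R a = a m\<close>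
  satisfying \<open>a (m b) = (a m) b\<close>. For a non-degenerate product the last identity implies all others.
\<close>

definition double_centralizer :: "('a::complex_alg \<Rightarrow> 'a) \<Rightarrow> ('a \<Rightarrow> 'a) \<Rightarrow> bool"
  where "double_centralizer L R \<longleftrightarrow> clinear L \<and> clinear R \<and>
    (\<forall>a b. L (a * b) = L a * b) \<and> (\<forall>a b. R (a * b) = a * R b) \<and> (\<forall>a b. a * L b = R a * b)"

typedef (overloaded) 'a multiplier = "{(L, R). double_centralizer (L :: 'a::complex_alg \<Rightarrow> 'a) R}"
  by (rule exI[of _ "(\<lambda>_. 0, \<lambda>_. 0)"]) (simp add: double_centralizer_def clinear_iff)

setup_lifting type_definition_multiplier

lift_definition mleft :: "'a::complex_alg multiplier \<Rightarrow> 'a \<Rightarrow> 'a" is fst .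
lift_definition mright :: "'a::complex_alg multiplier \<Rightarrow> 'a \<Rightarrow> 'a" is snd .

lemma multiplier_eqI: "(\<And>a. mleft m a = mleft n a) \<Longrightarrow> (\<And>a. mright m a = mright n a) \<Longrightarrow> m = n"
  by transfer (auto simp: fun_eq_iff)

instantiation multiplier :: (complex_alg) complex_alg
begin

lift_definition zero_multiplier :: "'a multiplier" is "(\<lambda>_. 0, \<lambda>_. 0)"
  by (simp add: double_centralizer_def clinear_iff)
lift_definition plus_multiplier :: "'a multiplier \<Rightarrow> 'a multiplier \<Rightarrow> 'a multiplier"
  is "\<lambda>(L, R) (L', R'). (\<lambda>x. L x + L' x, \<lambda>x. R x + R' x)"
  by (auto simp: double_centralizer_def clinear_iff scaleC_add_right algebra_simps)
lift_definition minus_multiplier :: "'a multiplier \<Rightarrow> 'a multiplier \<Rightarrow> 'a multiplier"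
  is "\<lambda>(L, R) (L', R'). (\<lambda>x. L x - L' x, \<lambda>x. R x - R' x)"
  by (auto simp: double_centralizer_def clinear_iff cvec.scale_right_diff_distrib algebra_simps)
lift_definition uminus_multiplier :: "'a multiplier \<Rightarrow> 'a multiplier"
  is "\<lambda>(L, R). (\<lambda>x. - L x, \<lambda>x. - R x)"
  by (auto simp: double_centralizer_def clinear_iff)
lift_definition scaleC_multiplier :: "complex \<Rightarrow> 'a multiplier \<Rightarrow> 'a multiplier"
  is "\<lambda>c (L, R). (\<lambda>x. c *\<^sub>C L x, \<lambda>x. c *\<^sub>C R x)"
  by (auto simp: double_centralizer_def clinear_iff scaleC_add_right cvec.scale_left_commute
      mult_scaleC_left mult_scaleC_right)
lift_definition times_multiplier :: "'a multiplier \<Rightarrow> 'a multiplier \<Rightarrow> 'a multiplier"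
  is "\<lambda>(L, R) (L', R'). (\<lambda>x. L (L' x), \<lambda>x. R' (R x))"
  by (auto simp: double_centralizer_def clinear_iff)

lemma mleft_simps [simp]:
  fixes m n :: "'a multiplier"
  shows "mleft 0 x = 0" "mleft (m + n) x = mleft m x + mleft n x"
    "mleft (m - n) x = mleft m x - mleft n x" "mleft (- m) x = - mleft m x"
    "mleft (c *\<^sub>C m) x = c *\<^sub>C mleft m x" "mleft (m * n) x = mleft m (mleft n x)"
  by (transfer; auto)+

lemma mright_simps [simp]:
  fixes m n :: "'a multiplier"
  shows "mright 0 x = 0" "mright (m + n) x = mright m x + mright n x"
    "mright (m - n) x = mright m x - mright n x" "mright (- m) x = - mright m x"
    "mright (c *\<^sub>C m) x = c *\<^sub>C mright m x" "mright (m * n) x = mright n (mright m x)"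
  by (transfer; auto)+

lemma multiplier_linear [simp]:
  fixes m :: "'a multiplier"
  shows "mleft m (x + y) = mleft m x + mleft m y" "mleft m (c *\<^sub>C x) = c *\<^sub>C mleft m x"
    "mright m (x + y) = mright m x + mright m y" "mright m (c *\<^sub>C x) = c *\<^sub>C mright m x"
  by (transfer; auto simp: double_centralizer_def clinear_iff)+

instance
  by (intro_classes; intro multiplier_eqI)
     (simp_all add: scaleC_add_right scaleC_add_left scaleC_scaleC scaleC_one algebra_simps)

end

instantiation multiplier :: (complex_alg) monoid_mult
begin

lift_definition one_multiplier :: "'a multiplier" is "(\<lambda>x. x, \<lambda>x. x)"
  by (simp add: double_centralizer_def clinear_iff)

lemma mleft_one [simp]: "mleft (1 :: 'a multiplier) x = x"
  by transfer simp

lemma mright_one [simp]: "mright (1 :: 'a multiplier) x = x"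
  by transfer simp

instance
  by (intro_classes; intro multiplier_eqI) simp_all

end

lift_definition to_M :: "'a::complex_alg \<Rightarrow> 'a multiplier" is "\<lambda>a. (\<lambda>x. a * x, \<lambda>x. x * a)"
  by (simp add: double_centralizer_def clinear_iff algebra_simps mult_scaleC_left mult_scaleC_right)

text \<open>
  The inverse of the embedding of \<open>A\<close> into \<open>M(A)\<close>, which is injective for a non-degenerate product;
  meaningful on the range of \<^const>\<open>to_M\<close> only.
\<close>

definition from_M :: "'a::complex_alg multiplier \<Rightarrow> 'a"
  where "from_M = inv to_M"

lemma double_centralizer_tensor:
  assumes "double_centralizer L R" "double_centralizer L' R'"
  shows "double_centralizer (tensor_map L L') (tensor_map R R')"
proof -
  have lin: "clinear L" "clinear R" "clinear L'" "clinear R'"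
    using assms by (simp_all add: double_centralizer_def)
  note [simp] = tensor_map_tensor[OF lin(1) lin(3)] tensor_map_tensor[OF lin(2) lin(4)]
    clinear_tensor_map[OF lin(1) lin(3), unfolded clinear_iff, THEN conjunct1, rule_format]
    clinear_tensor_map[OF lin(2) lin(4), unfolded clinear_iff, THEN conjunct1, rule_format]
  have 1: "tensor_map L L' (t * u) = tensor_map L L' t * u" for t u
  proof (induction t rule: tensor_induct)
    case (tensor a b)
    show ?case
      by (induction u rule: tensor_induct)
         (use assms in \<open>simp_all add: tensor_times_tensor double_centralizer_def distrib_left\<close>)
  qed (simp add: distrib_right)
  have 2: "tensor_map R R' (t * u) = t * tensor_map R R' u" for t u
  proof (induction t rule: tensor_induct)
    case (tensor a b)
    show ?case
      by (induction u rule: tensor_induct)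
         (use assms in \<open>simp_all add: tensor_times_tensor double_centralizer_def distrib_left\<close>)
  qed (simp add: distrib_right)
  have 3: "t * tensor_map L L' u = tensor_map R R' t * u" for t u
  proof (induction t rule: tensor_induct)
    case (tensor a b)
    show ?case
      by (induction u rule: tensor_induct)
         (use assms in \<open>simp_all add: tensor_times_tensor double_centralizer_def distrib_left\<close>)
  qed (simp add: distrib_right)
  show ?thesis
    using 1 2 3 lin by (simp add: double_centralizer_def clinear_tensor_map)
qed

lemma double_centralizer_id: "double_centralizer (\<lambda>x. x) (\<lambda>x. x)"
  by (simp add: double_centralizer_def clinear_iff)

lemma double_centralizer_transport:
  assumes "double_centralizer L R" and "clinear \<theta>" "clinear \<eta>" "\<And>x. \<theta> (\<eta> x) = x" "\<And>x. \<eta> (\<theta> x) = x"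
    and "\<And>x y. \<theta> (x * y) = \<theta> x * \<theta> y" "\<And>x y. \<eta> (x * y) = \<eta> x * \<eta> y"
  shows "double_centralizer (\<lambda>x. \<theta> (L (\<eta> x))) (\<lambda>x. \<theta> (R (\<eta> x)))"
proof -
  have "x * \<theta> (L (\<eta> y)) = \<theta> (R (\<eta> x)) * y" for x y
    using assms unfolding double_centralizer_def by metis
  then show ?thesis
    using assms by (auto simp: double_centralizer_def clinear_iff)
qed

lift_definition mtensor :: "'a::complex_alg multiplier \<Rightarrow> 'b::complex_alg multiplier \<Rightarrow> ('a \<otimes> 'b) multiplier"
    (infixr \<open>\<otimes>\<^sub>m\<close> 75)
  is "\<lambda>(L, R) (L', R'). (tensor_map L L', tensor_map R R')"
  by (auto intro: double_centralizer_tensor)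

text \<open>
  Leg numbering notation in \<open>M(A \<otimes> A \<otimes> A)\<close>; the triple tensor product is bracketed to the left.
\<close>

definition leg12 :: "('a::complex_alg \<otimes> 'a) multiplier \<Rightarrow> (('a \<otimes> 'a) \<otimes> 'a) multiplier"
  where "leg12 m = m \<otimes>\<^sub>m 1"

lift_definition leg23 :: "('a::complex_alg \<otimes> 'a) multiplier \<Rightarrow> (('a \<otimes> 'a) \<otimes> 'a) multiplier"
  is "\<lambda>(L, R). (\<lambda>t. tassoc' (tensor_map (\<lambda>x. x) L (tassoc t)), \<lambda>t. tassoc' (tensor_map (\<lambda>x. x) R (tassoc t)))"
proof -
  fix p :: "('a \<otimes> 'a \<Rightarrow> 'a \<otimes> 'a) \<times> ('a \<otimes> 'a \<Rightarrow> 'a \<otimes> 'a)"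
  assume "p \<in> {(L, R). double_centralizer L R}"
  then obtain L R where p: "p = (L, R)" "double_centralizer L R" by blast
  have "double_centralizer (tensor_map (\<lambda>x::'a. x) L) (tensor_map (\<lambda>x. x) R)"
    by (rule double_centralizer_tensor[OF double_centralizer_id p(2)])
  then have "double_centralizer (\<lambda>t. tassoc' (tensor_map (\<lambda>x::'a. x) L (tassoc t)))
      (\<lambda>t. tassoc' (tensor_map (\<lambda>x. x) R (tassoc t)))"
    by (rule double_centralizer_transport[where \<theta> = tassoc' and \<eta> = tassoc])
       (simp_all add: clinear_tassoc clinear_tassoc' tassoc'_mult tassoc_mult)
  then show "(case p of (L, R) \<Rightarrow> (\<lambda>t. tassoc' (tensor_map (\<lambda>x::'a. x) L (tassoc t)), \<lambda>t. tassoc' (tensor_map (\<lambda>x. x) R (tassoc t)))) \<in> {(L, R). double_centralizer L R}" by (simp add: p)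
qed

lift_definition leg13 :: "('a::complex_alg \<otimes> 'a) multiplier \<Rightarrow> (('a \<otimes> 'a) \<otimes> 'a) multiplier"
  is "\<lambda>(L, R). (\<lambda>t. tflip23 (tensor_map L (\<lambda>x. x) (tflip23 t)), \<lambda>t. tflip23 (tensor_map R (\<lambda>x. x) (tflip23 t)))"
proof -
  fix p :: "('a \<otimes> 'a \<Rightarrow> 'a \<otimes> 'a) \<times> ('a \<otimes> 'a \<Rightarrow> 'a \<otimes> 'a)"
  assume "p \<in> {(L, R). double_centralizer L R}"
  then obtain L R where p: "p = (L, R)" "double_centralizer L R" by blast
  have "double_centralizer (tensor_map L (\<lambda>x::'a. x)) (tensor_map R (\<lambda>x. x))"
    by (rule double_centralizer_tensor[OF p(2) double_centralizer_id])
  then have "double_centralizer (\<lambda>t. tflip23 (tensor_map L (\<lambda>x::'a. x) (tflip23 t)))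
      (\<lambda>t. tflip23 (tensor_map R (\<lambda>x. x) (tflip23 t)))"
    by (rule double_centralizer_transport[where \<theta> = tflip23 and \<eta> = tflip23])
       (simp_all add: clinear_tflip23 tflip23_mult)
  then show "(case p of (L, R) \<Rightarrow> (\<lambda>t. tflip23 (tensor_map L (\<lambda>x::'a. x) (tflip23 t)), \<lambda>t. tflip23 (tensor_map R (\<lambda>x. x) (tflip23 t)))) \<in> {(L, R). double_centralizer L R}" by (simp add: p)
qed

text \<open>
  The extension of a homomorphism \<open>\<gamma> : P \<rightarrow> M(Q)\<close> to \<open>M(P)\<close> with value \<open>e\<close> at \<open>1\<close>. It exists and is
  unique when \<open>Q\<close> is non-degenerate, \<open>e\<close> is idempotent, \<open>\<gamma>(P) Q = e Q\<close> and \<open>Q \<gamma>(P) = Q e\<close>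
  (for spans of products).
\<close>

definition extension_to_M ::
    "('p::complex_alg \<Rightarrow> 'q::complex_alg multiplier) \<Rightarrow> 'q multiplier \<Rightarrow> 'p multiplier \<Rightarrow> 'q multiplier"
  where "extension_to_M \<gamma> e = (THE D. clinear D \<and> (\<forall>m n. D (m * n) = D m * D n) \<and>
    (\<forall>p. D (to_M p) = \<gamma> p) \<and> D 1 = e)"

section \<open>Algebras with a coproduct\<close>

type_synonym 'a coprod = "'a \<Rightarrow> ('a \<otimes> 'a) multiplier"

definition nondegenerate_product :: "'a::complex_alg itself \<Rightarrow> bool"
  where "nondegenerate_product _ \<longleftrightarrow>
    (\<forall>a::'a. (\<forall>b. a * b = 0) \<longrightarrow> a = 0) \<and> (\<forall>a::'a. (\<forall>b. b * a = 0) \<longrightarrow> a = 0)"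

definition idempotent_algebra :: "'a::complex_alg itself \<Rightarrow> bool"
  where "idempotent_algebra _ \<longleftrightarrow> cvec.span {a * b | a b :: 'a. True} = UNIV"

definition T1 :: "'a::complex_alg coprod \<Rightarrow> 'a \<otimes> 'a \<Rightarrow> 'a \<otimes> 'a"
  where "T1 \<Delta> = tensor_lift (\<lambda>a b. from_M (\<Delta> a * (1 \<otimes>\<^sub>m to_M b)))"

definition T2 :: "'a::complex_alg coprod \<Rightarrow> 'a \<otimes> 'a \<Rightarrow> 'a \<otimes> 'a"
  where "T2 \<Delta> = tensor_lift (\<lambda>a b. from_M ((to_M a \<otimes>\<^sub>m 1) * \<Delta> b))"

definition coprod_tensor_id :: "'a::complex_alg coprod \<Rightarrow> 'a \<otimes> 'a \<Rightarrow> (('a \<otimes> 'a) \<otimes> 'a) multiplier"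
  where "coprod_tensor_id \<Delta> = tensor_lift (\<lambda>x y. \<Delta> x \<otimes>\<^sub>m to_M y)"

text \<open>Here \<open>x \<otimes> \<Delta>(y)\<close> is written as \<open>(x \<otimes> 1 \<otimes> 1)(1 \<otimes> \<Delta>(y))\<close>, because of the bracketing.\<close>

definition id_tensor_coprod :: "'a::complex_alg coprod \<Rightarrow> 'a \<otimes> 'a \<Rightarrow> (('a \<otimes> 'a) \<otimes> 'a) multiplier"
  where "id_tensor_coprod \<Delta> = tensor_lift (\<lambda>x y. ((to_M x \<otimes>\<^sub>m 1) \<otimes>\<^sub>m 1) * leg23 (\<Delta> y))"

definition left_slice :: "('a::complex_space \<Rightarrow> complex) \<Rightarrow> 'a \<otimes> 'a \<Rightarrow> 'a"
  where "left_slice f = tensor_lift (\<lambda>x y. f x *\<^sub>C y)"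

definition right_slice :: "('a::complex_space \<Rightarrow> complex) \<Rightarrow> 'a \<otimes> 'a \<Rightarrow> 'a"
  where "right_slice f = tensor_lift (\<lambda>x y. f y *\<^sub>C x)"

definition tensor_of_sets :: "'a::complex_space set \<Rightarrow> 'a set \<Rightarrow> ('a \<otimes> 'a) set"
  where "tensor_of_sets V W = cvec.span {v \<otimes>\<^sub>t w | v w. v \<in> V \<and> w \<in> W}"

text \<open>The legs of \<open>\<Delta>(X)\<close>: the smallest subspaces are formed as intersections.\<close>

definition left_leg :: "'a::complex_alg coprod \<Rightarrow> 'a set \<Rightarrow> 'a set"
  where "left_leg \<Delta> X = \<Inter>{V. cvec.subspace V \<and>
    (\<forall>x\<in>X. \<forall>a. \<Delta> x * (1 \<otimes>\<^sub>m to_M a) \<in> to_M ` tensor_of_sets V UNIV)}"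

definition right_leg :: "'a::complex_alg coprod \<Rightarrow> 'a set \<Rightarrow> 'a set"
  where "right_leg \<Delta> X = \<Inter>{W. cvec.subspace W \<and>
    (\<forall>x\<in>X. \<forall>a. (to_M a \<otimes>\<^sub>m 1) * \<Delta> x \<in> to_M ` tensor_of_sets UNIV W)}"

definition full_coprod :: "'a::complex_alg coprod \<Rightarrow> bool"
  where "full_coprod \<Delta> \<longleftrightarrow> left_leg \<Delta> UNIV = UNIV \<and> right_leg \<Delta> UNIV = UNIV"

locale coproduct =
  fixes \<Delta> :: "'a::complex_alg coprod"
  assumes nondegenerate: "nondegenerate_product TYPE('a)"
    and coprod_linear: "clinear \<Delta>"
    and coprod_mult: "\<Delta> (a * b) = \<Delta> a * \<Delta> b"
    and coprod_right: "\<Delta> a * (1 \<otimes>\<^sub>m to_M b) \<in> range to_M"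
    and coprod_left: "(to_M a \<otimes>\<^sub>m 1) * \<Delta> b \<in> range to_M"
    and coassoc: "((to_M a \<otimes>\<^sub>m 1) \<otimes>\<^sub>m 1) * coprod_tensor_id \<Delta> (from_M (\<Delta> b * (1 \<otimes>\<^sub>m to_M c)))
      = id_tensor_coprod \<Delta> (from_M ((to_M a \<otimes>\<^sub>m 1) * \<Delta> b)) * ((1 \<otimes>\<^sub>m 1) \<otimes>\<^sub>m to_M c)"

definition counit :: "'a::complex_alg coprod \<Rightarrow> ('a \<Rightarrow> complex) \<Rightarrow> bool"
  where "counit \<Delta> \<epsilon> \<longleftrightarrow> clinear \<epsilon> \<and>
    (\<forall>a b. left_slice \<epsilon> (from_M (\<Delta> a * (1 \<otimes>\<^sub>m to_M b))) = a * b) \<and>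
    (\<forall>a c. right_slice \<epsilon> (from_M ((to_M c \<otimes>\<^sub>m 1) * \<Delta> a)) = c * a)"

section \<open>Weak multiplier Hopf algebras\<close>

text \<open>
  The idempotent \<open>E\<close> and the maps \<open>G\<^sub>1\<close>, \<open>G\<^sub>2\<close> are uniquely determined by the axioms below; they are
  locale parameters so that they can be named.
\<close>

locale weak_multiplier_Hopf_algebra = coproduct \<Delta>
  for \<Delta> :: "'a::complex_alg coprod" +
  fixes \<epsilon> :: "'a \<Rightarrow> complex"
    and E :: "('a \<otimes> 'a) multiplier"
    and G1 G2 :: "'a \<otimes> 'a \<Rightarrow> 'a \<otimes> 'a"
  assumes idempotent_alg: "idempotent_algebra TYPE('a)"
    and full: "full_coprod \<Delta>"
    and counit: "counit \<Delta> \<epsilon>"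
    and E_idem: "E * E = E"
    and T1_range: "range (T1 \<Delta>) = range (mleft E)"
    and T2_range: "range (T2 \<Delta>) = range (mright E)"
    and E_coprod: "extension_to_M (id_tensor_coprod \<Delta>) (leg23 E) E = leg12 E * leg23 E"
    and E_commute: "leg12 E * leg23 E = leg23 E * leg12 E"
    and G1_linear: "clinear G1"
    and G1: "to_M (tensor_map G1 (\<lambda>x. x) (from_M (leg13 (\<Delta> a) * ((1 \<otimes>\<^sub>m to_M b) \<otimes>\<^sub>m to_M c))))
      = leg13 (\<Delta> a) * leg23 E * ((1 \<otimes>\<^sub>m to_M b) \<otimes>\<^sub>m to_M c)"
    and G2_linear: "clinear G2"
    and G2: "to_M (tassoc' (tensor_map (\<lambda>x. x) G2 (tassoc
        (from_M (((to_M a \<otimes>\<^sub>m to_M b) \<otimes>\<^sub>m 1) * leg13 (\<Delta> c))))))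
      = ((to_M a \<otimes>\<^sub>m to_M b) \<otimes>\<^sub>m 1) * leg12 E * leg13 (\<Delta> c)"
    and T1_kernel: "{t. T1 \<Delta> t = 0} = range (\<lambda>t. t - G1 t)"
    and T2_kernel: "{t. T2 \<Delta> t = 0} = range (\<lambda>t. t - G2 t)"

text \<open>
  Sweedler expressions involving the antipode are read through coverings:
  \<^item> \<open>R1 (a \<otimes> b) = \<Sum> a\<^sub>(\<^sub>1\<^sub>) \<otimes> S(a\<^sub>(\<^sub>2\<^sub>)) b\<close> is determined by
    \<open>(c \<otimes> 1) R1 (a \<otimes> b) = (id \<otimes> S)((c \<otimes> 1) \<Delta>(a)) (1 \<otimes> b)\<close>;
  \<^item> \<open>R2 (a \<otimes> b) = \<Sum> a S(b\<^sub>(\<^sub>1\<^sub>)) \<otimes> b\<^sub>(\<^sub>2\<^sub>)\<close> is determined by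
    \<open>R2 (a \<otimes> b) (1 \<otimes> c) = (a \<otimes> 1) (S \<otimes> id)(\<Delta>(b) (1 \<otimes> c))\<close>.
\<close>

definition antipode_R1 :: "'a::complex_alg coprod \<Rightarrow> ('a \<Rightarrow> 'a multiplier) \<Rightarrow> ('a \<otimes> 'a \<Rightarrow> 'a \<otimes> 'a) \<Rightarrow> bool"
  where "antipode_R1 \<Delta> S R1 \<longleftrightarrow> clinear R1 \<and>
    (\<forall>a b c. (to_M c \<otimes>\<^sub>m 1) * to_M (R1 (a \<otimes>\<^sub>t b)) =
      tensor_lift (\<lambda>p q. to_M p \<otimes>\<^sub>m S q) (from_M ((to_M c \<otimes>\<^sub>m 1) * \<Delta> a)) * (1 \<otimes>\<^sub>m to_M b))"

definition antipode_R2 :: "'a::complex_alg coprod \<Rightarrow> ('a \<Rightarrow> 'a multiplier) \<Rightarrow> ('a \<otimes> 'a \<Rightarrow> 'a \<otimes> 'a) \<Rightarrow> bool"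
  where "antipode_R2 \<Delta> S R2 \<longleftrightarrow> clinear R2 \<and>
    (\<forall>a b c. to_M (R2 (a \<otimes>\<^sub>t b)) * (1 \<otimes>\<^sub>m to_M c) =
      (to_M a \<otimes>\<^sub>m 1) * tensor_lift (\<lambda>p q. S p \<otimes>\<^sub>m to_M q) (from_M (\<Delta> b * (1 \<otimes>\<^sub>m to_M c))))"

text \<open>
  The five defining formulas, in order: \<open>T1 (R1 (a \<otimes> b)) = \<Sum> a\<^sub>(\<^sub>1\<^sub>) \<otimes> a\<^sub>(\<^sub>2\<^sub>) S(a\<^sub>(\<^sub>3\<^sub>)) b\<close>,
  \<open>T2 (R2 (a \<otimes> b)) = \<Sum> a S(b\<^sub>(\<^sub>1\<^sub>)) b\<^sub>(\<^sub>2\<^sub>) \<otimes> b\<^sub>(\<^sub>3\<^sub>)\<close>,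
  \<open>R1 (T1 (a \<otimes> b)) = \<Sum> a\<^sub>(\<^sub>1\<^sub>) \<otimes> S(a\<^sub>(\<^sub>2\<^sub>)) a\<^sub>(\<^sub>3\<^sub>) b\<close>,
  \<open>R2 (T2 (a \<otimes> b)) = \<Sum> a b\<^sub>(\<^sub>1\<^sub>) S(b\<^sub>(\<^sub>2\<^sub>)) \<otimes> b\<^sub>(\<^sub>3\<^sub>)\<close>, and
  \<open>\<Sum> S(a\<^sub>(\<^sub>1\<^sub>)) a\<^sub>(\<^sub>2\<^sub>) S(a\<^sub>(\<^sub>3\<^sub>)) b = S(a) b\<close>.
\<close>

definition antipode :: "'a::complex_alg coprod \<Rightarrow> ('a \<otimes> 'a) multiplier \<Rightarrow> ('a \<otimes> 'a \<Rightarrow> 'a \<otimes> 'a)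
    \<Rightarrow> ('a \<otimes> 'a \<Rightarrow> 'a \<otimes> 'a) \<Rightarrow> ('a \<Rightarrow> 'a multiplier) \<Rightarrow> bool"
  where "antipode \<Delta> E G1 G2 S \<longleftrightarrow>
    clinear S \<and> (\<forall>a b. S (a * b) = S b * S a) \<and>
    cvec.span {mleft (S a) b | a b. True} = UNIV \<and> cvec.span {mright (S a) b | a b. True} = UNIV \<and>
    (\<exists>R1 R2. antipode_R1 \<Delta> S R1 \<and> antipode_R2 \<Delta> S R2 \<and>
      (\<forall>a b. mleft E (a \<otimes>\<^sub>t b) = T1 \<Delta> (R1 (a \<otimes>\<^sub>t b))) \<and>
      (\<forall>a b. mright E (a \<otimes>\<^sub>t b) = T2 \<Delta> (R2 (a \<otimes>\<^sub>t b))) \<and>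
      (\<forall>a b. G1 (a \<otimes>\<^sub>t b) = R1 (T1 \<Delta> (a \<otimes>\<^sub>t b))) \<and>
      (\<forall>a b. G2 (a \<otimes>\<^sub>t b) = R2 (T2 \<Delta> (a \<otimes>\<^sub>t b))) \<and>
      (\<forall>a b. tensor_lift (\<lambda>p. mleft (S p)) (T1 \<Delta> (R1 (a \<otimes>\<^sub>t b))) = mleft (S a) b))"

locale regular_weak_multiplier_Hopf_algebra = weak_multiplier_Hopf_algebra \<Delta> \<epsilon> E G1 G2
  for \<Delta> :: "'a::complex_alg coprod" and \<epsilon> E G1 G2 +
  fixes S :: "'a \<Rightarrow> 'a multiplier"
  assumes antipode: "antipode \<Delta> E G1 G2 S"
    and antipode_bij: "bij_betw S UNIV (range to_M)"

text \<open>\<open>c \<epsilon>\<^sub>t(a) = \<Sum> c a\<^sub>(\<^sub>1\<^sub>) S(a\<^sub>(\<^sub>2\<^sub>))\<close>, where \<open>\<Sum> c a\<^sub>(\<^sub>1\<^sub>) \<otimes> a\<^sub>(\<^sub>2\<^sub>) = (c \<otimes> 1) \<Delta>(a)\<close> lies in \<open>A \<otimes> A\<close>.\<close>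

definition eps_t :: "'a::complex_alg coprod \<Rightarrow> ('a \<Rightarrow> 'a multiplier) \<Rightarrow> 'a \<Rightarrow> 'a multiplier"
  where "eps_t \<Delta> S a = (THE x. \<forall>c. to_M c * x =
    tensor_lift (\<lambda>p q. to_M p * S q) (from_M ((to_M c \<otimes>\<^sub>m 1) * \<Delta> a)))"

definition target_algebra :: "'a::complex_alg coprod \<Rightarrow> ('a \<otimes> 'a) multiplier \<Rightarrow> 'a multiplier set"
  where "target_algebra \<Delta> E = {x. extension_to_M \<Delta> E x = (x \<otimes>\<^sub>m 1) * E}"

text \<open>
  The multiplier \<open>(id \<otimes> f)\<Delta>(a)\<close>. That \<open>\<Delta>(a) (b \<otimes> 1)\<close> lies in \<open>A \<otimes> A\<close> is a consequence of regularity.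
\<close>

definition coprod_slice :: "'a::complex_alg coprod \<Rightarrow> ('a \<Rightarrow> complex) \<Rightarrow> 'a \<Rightarrow> 'a multiplier"
  where "coprod_slice \<Delta> f a = (THE x. \<forall>b.
    mleft x b = right_slice f (from_M (\<Delta> a * (to_M b \<otimes>\<^sub>m 1))) \<and>
    mright x b = right_slice f (from_M ((to_M b \<otimes>\<^sub>m 1) * \<Delta> a)))"

definition left_integral :: "'a::complex_alg coprod \<Rightarrow> ('a \<otimes> 'a) multiplier \<Rightarrow> ('a \<Rightarrow> complex) \<Rightarrow> bool"
  where "left_integral \<Delta> E \<phi> \<longleftrightarrow> clinear \<phi> \<and> \<phi> \<noteq> (\<lambda>_. 0) \<and> (\<forall>a. coprod_slice \<Delta> \<phi> a \<in> target_algebra \<Delta> E)"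

definition left_cointegral :: "'a::complex_alg coprod \<Rightarrow> ('a \<Rightarrow> 'a multiplier) \<Rightarrow> 'a multiplier \<Rightarrow> bool"
  where "left_cointegral \<Delta> S h \<longleftrightarrow> h \<noteq> 0 \<and> (\<forall>a. to_M a * h = eps_t \<Delta> S a * h)"

definition left_cointegrals :: "'a::complex_alg coprod \<Rightarrow> ('a \<Rightarrow> 'a multiplier) \<Rightarrow> 'a set"
  where "left_cointegrals \<Delta> S = {h. left_cointegral \<Delta> S (to_M h)} \<union> {0}"

definition discrete_type :: "'a::complex_alg coprod \<Rightarrow> ('a \<Rightarrow> 'a multiplier) \<Rightarrow> bool"
  where "discrete_type \<Delta> S \<longleftrightarrow>
    left_leg \<Delta> (left_cointegrals \<Delta> S) = UNIV \<and> right_leg \<Delta> (left_cointegrals \<Delta> S) = UNIV"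

end

theory Submission
  imports Defs
begin

text \<open>
  Write \<open>y\<^sub>a = (id \<otimes> \<phi>)\<Delta>(a)\<close>. The functional \<open>\<phi>\<close> is a left integral when every \<open>y\<^sub>a\<close> lies in
  \<open>A\<^sub>t\<close>, and the claim is that it is enough to test this on the left cointegrals \<open>h\<close>. The elements
  \<open>a\<close> with \<open>y\<^sub>a \<in> A\<^sub>t\<close> form a subspace and, by discreteness, the right leg of \<open>\<Delta>(H)\<close> is \<open>A\<close>, so
  \<open>A\<close> is spanned by the slices \<open>a = (\<omega> \<otimes> id)((b \<otimes> 1)\<Delta>(h))\<close> with \<open>h \<in> H\<close>, \<open>b \<in> A\<close> and \<open>\<omega> \<in> A'\<close>
  (\<open>in_tensor_of_sets_slice1\<close>). For such an \<open>a\<close>, coassociativity and \<open>y\<^sub>h \<in> A\<^sub>t\<close> give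

  \<open>y\<^sub>a = (\<omega> \<otimes> id)((b \<otimes> 1)(id \<otimes> id \<otimes> \<phi>)(id \<otimes> \<Delta>)(\<Delta>(h))) = (\<omega> \<otimes> id)((b \<otimes> 1)\<Delta>(y\<^sub>h)) = (\<omega> \<otimes> id)((b y\<^sub>h \<otimes> 1)E)\<close>.

  So \<open>y\<^sub>a\<close> lies in the right leg of \<open>E\<close>, and that leg lies in \<open>A\<^sub>t\<close> because
  \<open>(id \<otimes> \<Delta>)E = (E \<otimes> 1)(1 \<otimes> E)\<close>.

  None of these multipliers need lie in \<open>A \<otimes> A\<close>, so the computation is carried out after covering. The
  element \<open>covered_E d\<close> of \<open>A \<otimes> A\<close> represents \<open>(b y\<^sub>h \<otimes> 1)E(1 \<otimes> d)\<close>: \<open>covered_E_cover\<close> is the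
  covered form of the displayed formula, and \<open>coprod_covered_E\<close> is the covered form of
  \<open>(id \<otimes> \<Delta>)((b y\<^sub>h \<otimes> 1)E) = (b y\<^sub>h \<otimes> 1 \<otimes> 1)(E \<otimes> 1)(1 \<otimes> E)\<close>.

  Two general facts make the statement accessible. The extensions of \<open>\<Delta>\<close> and of \<open>id \<otimes> \<Delta>\<close> to
  multipliers exist and are determined by their action on the image of the homomorphism
  (\<open>extension_eq_iff\<close>); hence \<open>x \<in> A\<^sub>t\<close> means \<open>\<Delta>(x p) = (x \<otimes> 1)\<Delta>(p)\<close> for all \<open>p \<in> A\<close>. And
  \<open>\<Delta>(a)(d \<otimes> 1) \<in> A \<otimes> A\<close> follows from bijectivity of the antipode (\<open>coprod_first_cover\<close>), so
  that \<open>y\<^sub>a\<close> is a well-defined multiplier (\<open>coprod_slice_act\<close>).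
\<close>

section \<open>Slices of tensors\<close>

definition slice1 :: "('a::complex_space \<Rightarrow> complex) \<Rightarrow> 'a \<otimes> 'b::complex_space \<Rightarrow> 'b"
  where "slice1 f = tensor_lift (\<lambda>x y. f x *\<^sub>C y)"

definition slice2 :: "('b::complex_space \<Rightarrow> complex) \<Rightarrow> 'a::complex_space \<otimes> 'b \<Rightarrow> 'a"
  where "slice2 f = tensor_lift (\<lambda>x y. f y *\<^sub>C x)"

lemma right_slice_eq_slice2: "right_slice f = slice2 f"
  by (simp add: right_slice_def slice2_def)

lemma scaleC_complex: "c *\<^sub>C (z::complex) = c * z"
  by (simp add: scaleC_complex_def)

lemma clinear_add: "clinear f \<Longrightarrow> f (x + y) = f x + f y"
  by (simp add: clinear_iff)

lemma clinear_scale: "clinear f \<Longrightarrow> f (c *\<^sub>C x) = c *\<^sub>C f x"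
  by (simp add: clinear_iff)

lemma clinear_zero: "clinear f \<Longrightarrow> f 0 = 0"
  using clinear_scale[of f 0 0] by simp

lemma clinear_comp: "clinear f \<Longrightarrow> clinear g \<Longrightarrow> clinear (\<lambda>x. f (g x))"
  by (simp add: clinear_iff)

lemma clinear_add_fun: "clinear f \<Longrightarrow> clinear g \<Longrightarrow> clinear (\<lambda>x. f x + g x)"
  by (simp add: clinear_iff scaleC_add_right)

lemma clinear_id: "clinear (\<lambda>x. x)"
  by (simp add: clinear_iff)

lemma cbilinear_slices:
  assumes "clinear f"
  shows "cbilinear (\<lambda>x y. f x *\<^sub>C y)" "cbilinear (\<lambda>x y. f y *\<^sub>C x)"
  using assms
  by (simp_all add: cbilinear_iff clinear_add clinear_scale scaleC_complex scaleC_add_right scaleC_add_left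
      scaleC_scaleC mult.commute)

lemma
  assumes "clinear f"
  shows clinear_slice1: "clinear (slice1 f)" and slice1_tensor: "slice1 f (x \<otimes>\<^sub>t y) = f x *\<^sub>C y"
    and clinear_slice2: "clinear (slice2 f)" and slice2_tensor: "slice2 f (x' \<otimes>\<^sub>t y') = f y' *\<^sub>C x'"
  unfolding slice1_def slice2_def
  by (rule clinear_tensor_lift cbilinear_slices assms tensor_lift_tensor[OF cbilinear_slices(1)] tensor_lift_tensor[OF cbilinear_slices(2)])+

lemma tensor_zero [simp]: "0 \<otimes>\<^sub>t y = 0" "x \<otimes>\<^sub>t 0 = 0"
  using clinear_zero[OF cbilinear_tensor[unfolded cbilinear_def, THEN conjunct1, rule_format]]
    clinear_zero[OF cbilinear_tensor[unfolded cbilinear_def, THEN conjunct2, rule_format]]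
  by fast+

lemma tensor_sum_left: "(\<Sum>i\<in>I. g i) \<otimes>\<^sub>t y = (\<Sum>i\<in>I. g i \<otimes>\<^sub>t y)"
  by (induction I rule: infinite_finite_induct) (simp_all add: tensor_simps)

text \<open>
  Expand the first leg in a basis and take for \<open>f v\<close> the coordinate functionals. The sum over a finite
  part of the basis is correct as soon as that part is large enough; this form is stable under
  addition of tensors, which is what the induction needs.
\<close>

lemma slice_expansion:
  fixes t :: "'a::complex_space \<otimes> 'b::complex_space"
  obtains V :: "'a set" and f :: "'a \<Rightarrow> 'a \<Rightarrow> complex"
  where "finite V" and "\<And>v. clinear (f v)" and "t = (\<Sum>v\<in>V. v \<otimes>\<^sub>t slice1 (f v) t)"
proof -
  define B :: "'a set" where "B = cvec.extend_basis {}"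
  have indep: "cvec.independent B" and span: "cvec.span B = UNIV"
    unfolding B_def by (simp_all add: cvec.independent_extend_basis cvec.span_extend_basis cvec.independent_empty)
  define f where "f v a = cvec.representation B a v" for v a
  have lin: "clinear (f v)" for v
    unfolding f_def clinear_iff
    by (simp add: scaleC_complex cvec.representation_add[OF indep] cvec.representation_scale[OF indep] span)
  have "\<exists>V. finite V \<and> (\<forall>V'. finite V' \<longrightarrow> V \<subseteq> V' \<longrightarrow> t = (\<Sum>v\<in>V'. v \<otimes>\<^sub>t slice1 (f v) t))"
  proof (induction t rule: tensor_induct)
    case (tensor a b)
    let ?V = "{v. f v a \<noteq> 0}"
    have "a \<otimes>\<^sub>t b = (\<Sum>v\<in>V'. v \<otimes>\<^sub>t slice1 (f v) (a \<otimes>\<^sub>t b))" if V': "finite V'" "?V \<subseteq> V'" for V'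
    proof -
      have "(\<Sum>v\<in>V'. f v a *\<^sub>C v) = (\<Sum>v\<in>?V. f v a *\<^sub>C v)"
        by (rule sum.mono_neutral_right) (use V' in auto)
      also have "\<dots> = a"
        unfolding f_def by (rule cvec.sum_nonzero_representation_eq) (simp_all add: indep span)
      finally have a: "(\<Sum>v\<in>V'. f v a *\<^sub>C v) = a" .
      have "(\<Sum>v\<in>V'. v \<otimes>\<^sub>t slice1 (f v) (a \<otimes>\<^sub>t b)) = (\<Sum>v\<in>V'. f v a *\<^sub>C v) \<otimes>\<^sub>t b"
        by (simp add: tensor_sum_left slice1_tensor lin tensor_simps)
      then show ?thesis by (simp add: a)
    qed
    moreover have "finite ?V" unfolding f_def by (rule cvec.finite_representation)
    ultimately show ?case by blast
  next
    case (add x y)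
    then obtain V W where V: "finite V" "\<forall>V'. finite V' \<longrightarrow> V \<subseteq> V' \<longrightarrow> x = (\<Sum>v\<in>V'. v \<otimes>\<^sub>t slice1 (f v) x)"
      and W: "finite W" "\<forall>V'. finite V' \<longrightarrow> W \<subseteq> V' \<longrightarrow> y = (\<Sum>v\<in>V'. v \<otimes>\<^sub>t slice1 (f v) y)" by blast
    have "x + y = (\<Sum>v\<in>V'. v \<otimes>\<^sub>t slice1 (f v) (x + y))" if "finite V'" "V \<union> W \<subseteq> V'" for V'
    proof -
      have "x = (\<Sum>v\<in>V'. v \<otimes>\<^sub>t slice1 (f v) x)" "y = (\<Sum>v\<in>V'. v \<otimes>\<^sub>t slice1 (f v) y)"
        using that V(2) W(2) by auto
      then show ?thesis
        by (simp add: clinear_add[OF clinear_slice1[OF lin]] tensor_simps sum.distrib)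
    qed
    then show ?case using V(1) W(1) by (intro exI[of _ "V \<union> W"]) auto
  qed
  then show ?thesis using that lin by (metis subset_refl)
qed

text \<open>
  This is how the leg of a set of tensors is reached: a subspace containing all slices of \<open>t\<close>
  contains a leg of \<open>t\<close>.
\<close>

lemma in_tensor_of_sets_slice1:
  assumes "\<And>f. clinear f \<Longrightarrow> slice1 f t \<in> W"
  shows "t \<in> tensor_of_sets UNIV W"
proof -
  obtain V f where "finite V" and "\<And>v. clinear (f v)" and t: "t = (\<Sum>v\<in>V. v \<otimes>\<^sub>t slice1 (f v) t)"
    by (rule slice_expansion[of t]) (rule that)
  then have "(\<Sum>v\<in>V. v \<otimes>\<^sub>t slice1 (f v) t) \<in> tensor_of_sets UNIV W"
    unfolding tensor_of_sets_def by (intro cvec.span_sum cvec.span_base) (use assms in blast)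
  then show ?thesis using t by simp
qed

lemma slice1_separating:
  assumes "\<And>f. clinear f \<Longrightarrow> slice1 f t = 0"
  shows "t = 0"
proof -
  obtain V f where "finite V" and "\<And>v. clinear (f v)" and t: "t = (\<Sum>v\<in>V. v \<otimes>\<^sub>t slice1 (f v) t)"
    by (rule slice_expansion[of t]) (rule that)
  then show ?thesis using assms by simp
qed

lemma functionals_separating:
  fixes x :: "'a::complex_space"
  assumes "\<And>f. clinear f \<Longrightarrow> f x = (0::complex)"
  shows "x = 0"
proof -
  define B :: "'a set" where "B = cvec.extend_basis {}"
  have B: "cvec.independent B" "cvec.span B = UNIV"
    unfolding B_def by (simp_all add: cvec.independent_extend_basis cvec.span_extend_basis cvec.independent_empty)
  have "clinear (\<lambda>a. cvec.representation B a v)" for v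
    unfolding clinear_iff
    by (simp add: scaleC_complex cvec.representation_add[OF B(1)] cvec.representation_scale[OF B(1)] B)
  then have "cvec.representation B x v = 0" for v using assms by blast
  then have "(\<Sum>v | cvec.representation B x v \<noteq> 0. cvec.representation B x v *\<^sub>C v) = 0" by simp
  then show ?thesis using cvec.sum_nonzero_representation_eq[OF B(1)] B(2) by (metis UNIV_I)
qed

text \<open>
  Both sides are \<open>(f \<otimes> g)(t)\<close>.
\<close>

lemma slice_slice:
  assumes "clinear f" "clinear g"
  shows "f (slice2 g t) = g (slice1 f t)"
  using assms
  by (induction t rule: tensor_induct)
    (simp_all add: slice1_tensor slice2_tensor clinear_add[OF clinear_slice1] clinear_add[OF clinear_slice2]
      clinear_add[of f] clinear_add[of g] clinear_scale[of f] clinear_scale[of g] scaleC_complex)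

text \<open>
  If \<open>t (c \<otimes> d) = 0\<close> for all \<open>c, d\<close>, slicing the second leg leaves a factor \<open>c\<close> that cancels in the
  first algebra; as functionals separate points, a slice of the first leg is then killed by every \<open>d\<close>
  and vanishes by non-degeneracy of the second algebra.
\<close>

lemma nondegenerate_tensor:
  assumes A: "nondegenerate_product TYPE('a::complex_alg)" and B: "nondegenerate_product TYPE('b::complex_alg)"
  shows "nondegenerate_product TYPE('a \<otimes> 'b)"
proof -
  have "t = 0" if "\<And>u. t * u = 0" for t :: "'a \<otimes> 'b"
  proof (rule slice1_separating)
    fix f :: "'a \<Rightarrow> complex" assume f: "clinear f"
    have 1: "slice2 g (t * (c \<otimes>\<^sub>t d)) = slice2 (\<lambda>b. g (b * d)) t * c" if "clinear g" for c d and g :: "'b \<Rightarrow> complex"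
    proof -
      have l: "clinear (\<lambda>b. g (b * d))" using that
        by (simp add: clinear_iff distrib_right mult_scaleC_left)
      show ?thesis
        by (induction t rule: tensor_induct)
          (simp_all add: tensor_times_tensor slice2_tensor that l mult_scaleC_left distrib_right
            clinear_add[OF clinear_slice2])
    qed
    have 2: "slice2 (\<lambda>b. g (b * d)) t = 0" if "clinear g" for g :: "'b \<Rightarrow> complex" and d
      using 1[OF that] \<open>\<And>u. t * u = 0\<close> A clinear_zero[OF clinear_slice2[OF that]]
      unfolding nondegenerate_product_def by metis
    have "slice1 f t * d = 0" for d
    proof (rule functionals_separating)
      fix g :: "'b \<Rightarrow> complex" assume g: "clinear g"
      have l: "clinear (\<lambda>b. g (b * d))" using g
        by (simp add: clinear_iff distrib_right mult_scaleC_left)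
      show "g (slice1 f t * d) = 0"
        using slice_slice[OF f l, of t] 2[OF g] by (simp add: clinear_zero f)
    qed
    then show "slice1 f t = 0" using B unfolding nondegenerate_product_def by blast
  qed
  moreover have "t = 0" if "\<And>u. u * t = 0" for t :: "'a \<otimes> 'b"
  proof (rule slice1_separating)
    fix f :: "'a \<Rightarrow> complex" assume f: "clinear f"
    have 1: "slice2 g ((c \<otimes>\<^sub>t d) * t) = c * slice2 (\<lambda>b. g (d * b)) t" if "clinear g" for c d and g :: "'b \<Rightarrow> complex"
    proof -
      have l: "clinear (\<lambda>b. g (d * b))" using that
        by (simp add: clinear_iff distrib_left mult_scaleC_right)
      show ?thesis
        by (induction t rule: tensor_induct)
          (simp_all add: tensor_times_tensor slice2_tensor that l mult_scaleC_right distrib_left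
            clinear_add[OF clinear_slice2])
    qed
    have 2: "slice2 (\<lambda>b. g (d * b)) t = 0" if "clinear g" for g :: "'b \<Rightarrow> complex" and d
      using 1[OF that] \<open>\<And>u. u * t = 0\<close> A clinear_zero[OF clinear_slice2[OF that]]
      unfolding nondegenerate_product_def by metis
    have "d * slice1 f t = 0" for d
    proof (rule functionals_separating)
      fix g :: "'b \<Rightarrow> complex" assume g: "clinear g"
      have l: "clinear (\<lambda>b. g (d * b))" using g
        by (simp add: clinear_iff distrib_left mult_scaleC_right)
      show "g (d * slice1 f t) = 0"
        using slice_slice[OF f l, of t] 2[OF g] by (simp add: clinear_zero f)
    qed
    then show "slice1 f t = 0" using B unfolding nondegenerate_product_def by blast
  qed
  ultimately show ?thesis unfolding nondegenerate_product_def by blast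
qed

lemma idempotent_tensor:
  assumes A: "idempotent_algebra TYPE('a::complex_alg)" and B: "idempotent_algebra TYPE('b::complex_alg)"
  shows "idempotent_algebra TYPE('a \<otimes> 'b)"
proof -
  let ?S = "cvec.span {x * y | x y :: 'a \<otimes> 'b. True}"
  have "a \<otimes>\<^sub>t b \<in> ?S" for a b
  proof -
    have "a \<in> cvec.span {x * y | x y :: 'a. True}" "b \<in> cvec.span {x * y | x y :: 'b. True}"
      using A B by (simp_all add: idempotent_algebra_def)
    then show ?thesis
    proof (induction a rule: cvec.span_induct)
      case base
      then show ?case
        by (auto simp: cvec.subspace_def cvec.span_zero tensor_simps intro: cvec.span_add cvec.span_scale)
    next
      case (step a)
      then obtain x y where a: "a = x * y" by blast
      from step(2) show ?case
      proof (induction b rule: cvec.span_induct)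
        case base
        then show ?case
          by (auto simp: cvec.subspace_def cvec.span_zero tensor_simps intro: cvec.span_add cvec.span_scale)
      next
        case (step b)
        then obtain z w where "b = z * w" by blast
        then have "a \<otimes>\<^sub>t b = (x \<otimes>\<^sub>t z) * (y \<otimes>\<^sub>t w)" by (simp add: a tensor_times_tensor)
        then show ?case by (auto intro: cvec.span_base)
      qed
    qed
  qed
  then have "t \<in> ?S" for t
    by (induction t rule: tensor_induct) (auto intro: cvec.span_add)
  then show ?thesis unfolding idempotent_algebra_def by blast
qed

section \<open>Multipliers and slices of tensor products\<close>

lemma nondegenerate_left:
  assumes "nondegenerate_product TYPE('a::complex_alg)" and "\<And>u. t * u = t' * u"
  shows "t = (t' :: 'a)"
proof -
  have "(t - t') * u = 0" for u by (simp add: left_diff_distrib assms(2))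
  then have "t - t' = 0" using assms(1) unfolding nondegenerate_product_def by blast
  then show ?thesis by simp
qed

lemma nondegenerate_right:
  assumes "nondegenerate_product TYPE('a::complex_alg)" and "\<And>u. u * t = u * t'"
  shows "t = (t' :: 'a)"
proof -
  have "u * (t - t') = 0" for u by (simp add: right_diff_distrib assms(2))
  then have "t - t' = 0" using assms(1) unfolding nondegenerate_product_def by blast
  then show ?thesis by simp
qed

lemma multiplier_balance: "a * mleft m b = mright m a * b"
  by (transfer; auto simp: double_centralizer_def)

lemma mleft_mult: "mleft m (a * b) = mleft m a * b"
  by (transfer; auto simp: double_centralizer_def)

lemma mright_mult: "mright m (a * b) = a * mright m b"
  by (transfer; auto simp: double_centralizer_def)

lemma clinear_mleft: "clinear (mleft m)" and clinear_mright: "clinear (mright m)"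
  by (simp_all add: clinear_iff)

text \<open>
  For a non-degenerate product either of the two actions determines a multiplier, because
  \<open>a (m b) = (a m) b\<close>.
\<close>

lemma multiplier_eq_left:
  fixes m :: "'a::complex_alg multiplier"
  assumes "nondegenerate_product TYPE('a)" and eq: "\<And>a. mleft m a = mleft n a"
  shows "m = n"
proof (rule multiplier_eqI)
  fix a show "mright m a = mright n a"
    by (rule nondegenerate_left[OF assms(1)]) (simp add: multiplier_balance[symmetric] eq)
qed (rule eq)

lemma multiplier_eq_right:
  fixes m :: "'a::complex_alg multiplier"
  assumes "nondegenerate_product TYPE('a)" and eq: "\<And>a. mright m a = mright n a"
  shows "m = n"
proof (rule multiplier_eqI)
  fix a show "mleft m a = mleft n a"
    by (rule nondegenerate_right[OF assms(1)]) (simp add: multiplier_balance eq)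
qed (rule eq)

lemma mleft_to_M [simp]: "mleft (to_M a) b = a * b" and mright_to_M [simp]: "mright (to_M a) b = b * a"
  by (transfer; simp)+

lemma clinear_to_M: "clinear to_M"
  unfolding clinear_iff
  by (intro conjI allI multiplier_eqI) (simp_all add: distrib_left distrib_right mult_scaleC_left mult_scaleC_right)

lemma to_M_mult: "to_M (a * b) = to_M a * to_M b"
  by (rule multiplier_eqI) (simp_all add: mult.assoc)

lemma mult_to_M: "m * to_M a = to_M (mleft m a)"
  by (rule multiplier_eqI) (simp_all add: multiplier_balance mleft_mult)

lemma to_M_times: "to_M a * m = to_M (mright m a)"
  by (rule multiplier_eqI) (simp_all add: multiplier_balance mright_mult)

lemma inj_to_M:
  assumes "nondegenerate_product TYPE('a::complex_alg)"
  shows "inj (to_M :: 'a \<Rightarrow> _)"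
proof (rule injI)
  fix a b :: 'a assume "to_M a = to_M b"
  then have "mleft (to_M a) u = mleft (to_M b) u" for u by simp
  then show "a = b" by - (rule nondegenerate_left[OF assms], simp)
qed

lemma to_M_from_M: "m \<in> range to_M \<Longrightarrow> to_M (from_M m) = m"
  unfolding from_M_def by (rule f_inv_into_f)

lemma mleft_mtensor_map: "mleft (m \<otimes>\<^sub>m n) = tensor_map (mleft m) (mleft n)"
  and mright_mtensor_map: "mright (m \<otimes>\<^sub>m n) = tensor_map (mright m) (mright n)"
  by (transfer; auto)+

lemma mleft_mtensor [simp]: "mleft (m \<otimes>\<^sub>m n) (x \<otimes>\<^sub>t y) = mleft m x \<otimes>\<^sub>t mleft n y"
  and mright_mtensor [simp]: "mright (m \<otimes>\<^sub>m n) (x \<otimes>\<^sub>t y) = mright m x \<otimes>\<^sub>t mright n y"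
  by (simp_all add: mleft_mtensor_map mright_mtensor_map tensor_map_tensor clinear_mleft clinear_mright)

lemma multiplier_tensor_eqI:
  assumes "\<And>a b. mleft m (a \<otimes>\<^sub>t b) = mleft n (a \<otimes>\<^sub>t b)" "\<And>a b. mright m (a \<otimes>\<^sub>t b) = mright n (a \<otimes>\<^sub>t b)"
  shows "m = n"
proof (rule multiplier_eqI)
  fix t
  show "mleft m t = mleft n t"
    by (rule clinear_tensor_eqI[OF clinear_mleft clinear_mleft assms(1)])
  show "mright m t = mright n t"
    by (rule clinear_tensor_eqI[OF clinear_mright clinear_mright assms(2)])
qed

lemma to_M_tensor: "to_M (a \<otimes>\<^sub>t b) = to_M a \<otimes>\<^sub>m to_M b"
  by (rule multiplier_tensor_eqI) (simp_all add: tensor_times_tensor)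

lemma mtensor_mult: "(m \<otimes>\<^sub>m n) * (m' \<otimes>\<^sub>m n') = (m * m') \<otimes>\<^sub>m (n * n')"
  by (rule multiplier_tensor_eqI) simp_all

lemma mtensor_one [simp]: "1 \<otimes>\<^sub>m 1 = 1"
  by (rule multiplier_tensor_eqI) simp_all

lemma cbilinear_mtensor: "cbilinear (\<otimes>\<^sub>m)"
  unfolding cbilinear_iff
  by (intro conjI allI multiplier_tensor_eqI) (simp_all add: tensor_simps)

lemma mleft_leg23: "mleft (leg23 m) t = tassoc' (tensor_map (\<lambda>x. x) (mleft m) (tassoc t))"
  and mright_leg23: "mright (leg23 m) t = tassoc' (tensor_map (\<lambda>x. x) (mright m) (tassoc t))"
  by (transfer; auto)+

lemma leg23_tassoc':
  "mleft (leg23 m) (tassoc' (a \<otimes>\<^sub>t u)) = tassoc' (a \<otimes>\<^sub>t mleft m u)"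
  "mright (leg23 m) (tassoc' (a \<otimes>\<^sub>t u)) = tassoc' (a \<otimes>\<^sub>t mright m u)"
  by (simp_all add: mleft_leg23 mright_leg23 tensor_map_tensor clinear_id clinear_mleft clinear_mright)

lemma leg23_tensor [simp]:
  "mleft (leg23 m) ((a \<otimes>\<^sub>t b) \<otimes>\<^sub>t c) = tassoc' (a \<otimes>\<^sub>t mleft m (b \<otimes>\<^sub>t c))"
  "mright (leg23 m) ((a \<otimes>\<^sub>t b) \<otimes>\<^sub>t c) = tassoc' (a \<otimes>\<^sub>t mright m (b \<otimes>\<^sub>t c))"
  by (simp_all add: mleft_leg23 mright_leg23 tassoc_tensor tensor_map_tensor clinear_id clinear_mleft clinear_mright)

lemma multiplier_tensor3_eqI:
  fixes m :: "(('a::complex_alg \<otimes> 'b::complex_alg) \<otimes> 'c::complex_alg) multiplier"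
  assumes "\<And>a b c. mleft m ((a \<otimes>\<^sub>t b) \<otimes>\<^sub>t c) = mleft n ((a \<otimes>\<^sub>t b) \<otimes>\<^sub>t c)"
    "\<And>a b c. mright m ((a \<otimes>\<^sub>t b) \<otimes>\<^sub>t c) = mright n ((a \<otimes>\<^sub>t b) \<otimes>\<^sub>t c)"
  shows "m = n"
proof (rule multiplier_eqI)
  fix t show "mleft m t = mleft n t"
    by (induction t rule: tensor3_induct) (simp_all add: assms)
  show "mright m t = mright n t"
    by (induction t rule: tensor3_induct) (simp_all add: assms)
qed

lemma leg23_mult: "leg23 (m * n) = leg23 m * leg23 n"
  by (rule multiplier_tensor3_eqI) (simp_all add: leg23_tassoc')

lemma clinear_leg23: "clinear leg23"
  unfolding clinear_iff
  by (intro conjI allI multiplier_tensor3_eqI)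
    (simp_all add: tensor_simps tassoc'_add clinear_scale[OF clinear_tassoc'])

lemma mtensor_tassoc':
  "mleft ((m \<otimes>\<^sub>m 1) \<otimes>\<^sub>m 1) (tassoc' (a \<otimes>\<^sub>t u)) = tassoc' (mleft m a \<otimes>\<^sub>t u)"
  "mright ((m \<otimes>\<^sub>m 1) \<otimes>\<^sub>m 1) (tassoc' (a \<otimes>\<^sub>t u)) = tassoc' (mright m a \<otimes>\<^sub>t u)"
  by (induction u rule: tensor_induct) (simp_all add: tassoc'_tensor tensor_simps tassoc'_add)

lemma leg1_leg23_commute: "((m \<otimes>\<^sub>m 1) \<otimes>\<^sub>m 1) * leg23 n = leg23 n * ((m \<otimes>\<^sub>m 1) \<otimes>\<^sub>m 1)"
  by (rule multiplier_tensor3_eqI) (simp_all add: mtensor_tassoc')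

lemma mleft_mright_commute:
  fixes x :: "'a::complex_alg"
  assumes "nondegenerate_product TYPE('a)"
  shows "mright n (mleft m x) = mleft m (mright n x)"
  by (rule nondegenerate_right[OF assms]) (simp add: multiplier_balance mright_mult[symmetric])

lemmas tensor_map_add = clinear_add[OF clinear_tensor_map]

lemma tensor_map_act_second:
  assumes "clinear f"
  shows "mright (1 \<otimes>\<^sub>m m) (tensor_map f (\<lambda>x. x) u) = tensor_map f (\<lambda>x. x) (mright (1 \<otimes>\<^sub>m m) u)"
  by (induction u rule: tensor_induct)
    (simp_all add: tensor_map_tensor tensor_map_add assms clinear_id)

lemma slice2_act:
  assumes "clinear f"
  shows "slice2 f (mleft (m \<otimes>\<^sub>m 1) t) = mleft m (slice2 f t)"
    and "slice2 f (mright (m \<otimes>\<^sub>m 1) t) = mright m (slice2 f t)"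
  by (induction t rule: tensor_induct)
    (simp_all add: slice2_tensor assms clinear_add[OF clinear_slice2[OF assms]])

lemma slice2_tensor_map:
  assumes "clinear f" "clinear g"
  shows "slice2 f (tensor_map g (\<lambda>x. x) t) = g (slice2 f t)"
  by (induction t rule: tensor_induct)
    (simp_all add: tensor_map_tensor tensor_map_add assms clinear_id slice2_tensor clinear_add[OF clinear_slice2]
       clinear_add[of g] clinear_scale[of g])

lemma slice1_tensor_map:
  assumes "clinear f" "clinear g"
  shows "slice1 f (tensor_map (\<lambda>x. x) g t) = g (slice1 f t)"
  by (induction t rule: tensor_induct)
    (simp_all add: tensor_map_tensor tensor_map_add assms clinear_id slice1_tensor clinear_add[OF clinear_slice1]
       clinear_add[of g] clinear_scale[of g])

lemma slice2_tassoc':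
  assumes "clinear f"
  shows "slice2 f (tassoc' (a \<otimes>\<^sub>t u)) = a \<otimes>\<^sub>t slice2 f u"
  by (induction u rule: tensor_induct)
    (simp_all add: tassoc'_tensor tassoc'_add assms slice2_tensor clinear_add[OF clinear_slice2] tensor_simps)

lemma slice1_tassoc:
  assumes "clinear f"
  shows "slice1 f (tassoc (u \<otimes>\<^sub>t c)) = slice1 f u \<otimes>\<^sub>t c"
  by (induction u rule: tensor_induct)
    (simp_all add: tassoc_tensor tassoc_add assms slice1_tensor clinear_add[OF clinear_slice1] tensor_simps)

lemma tassoc'_act_third: "mright (1 \<otimes>\<^sub>m m) (tassoc' (a \<otimes>\<^sub>t u)) = tassoc' (a \<otimes>\<^sub>t mright (1 \<otimes>\<^sub>m m) u)"
  by (induction u rule: tensor_induct) (simp_all add: tassoc'_tensor tassoc'_add tensor_simps)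

lemma tassoc'_act_first_two:
  "mright ((m \<otimes>\<^sub>m n) \<otimes>\<^sub>m 1) (tassoc' (a \<otimes>\<^sub>t u)) = tassoc' (mright m a \<otimes>\<^sub>t mright (n \<otimes>\<^sub>m 1) u)"
  by (induction u rule: tensor_induct) (simp_all add: tassoc'_tensor tassoc'_add tensor_simps)

lemma cbilinear_lift_params:
  assumes "\<And>p q. cbilinear (F p q)" and "\<And>r d. cbilinear (\<lambda>p q. F p q r d)"
  shows "cbilinear (\<lambda>p q. tensor_lift (F p q) w)"
proof (induction w rule: tensor_induct)
  case (tensor r d)
  show ?case using assms(2) by (simp add: tensor_lift_tensor assms(1))
next
  case (add x y)
  then show ?case
    by (simp add: cbilinear_iff clinear_add[OF clinear_tensor_lift[OF assms(1)]] scaleC_add_right)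
qed

section \<open>Extending homomorphisms to multiplier algebras\<close>

text \<open>
  The span conditions say \<open>\<gamma>(P) Q = e Q\<close> and \<open>Q \<gamma>(P) = Q e\<close>. They are what replaces
  \<open>\<gamma>(1) = 1\<close>: a multiplier \<open>M = M e\<close> of \<open>Q\<close> is known once all \<open>M \<gamma>(p)\<close> are known.
\<close>

locale nondegenerate_hom =
  fixes \<gamma> :: "'p::complex_alg \<Rightarrow> 'q::complex_alg multiplier" and e :: "'q multiplier"
  assumes nondeg: "nondegenerate_product TYPE('q)"
    and lin: "clinear \<gamma>"
    and hom: "\<gamma> (p * q) = \<gamma> p * \<gamma> q"
    and idem: "e * e = e"
    and left_range: "cvec.span {mleft (\<gamma> p) x | p x. True} = range (mleft e)"
    and right_range: "cvec.span {mright (\<gamma> p) x | p x. True} = range (mright e)"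
begin

lemma mleft_e_idem [simp]: "mleft e (mleft e x) = mleft e x"
  by (metis idem mleft_simps(6))

lemma mright_e_idem [simp]: "mright e (mright e x) = mright e x"
  by (metis idem mright_simps(6))

lemma e_hom: "e * \<gamma> p = \<gamma> p"
proof (rule multiplier_eq_left[OF nondeg])
  fix x
  have "mleft (\<gamma> p) x \<in> range (mleft e)"
    unfolding left_range[symmetric] by (rule cvec.span_base) blast
  then show "mleft (e * \<gamma> p) x = mleft (\<gamma> p) x" by auto
qed

lemma hom_e: "\<gamma> p * e = \<gamma> p"
proof (rule multiplier_eq_right[OF nondeg])
  fix x
  have "mright (\<gamma> p) x \<in> range (mright e)"
    unfolding right_range[symmetric] by (rule cvec.span_base) blast
  then show "mright (\<gamma> p * e) x = mright (\<gamma> p) x" by auto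
qed

lemma e_hom_act [simp]: "mleft e (mleft (\<gamma> p) x) = mleft (\<gamma> p) x" "mright (\<gamma> p) (mright e x) = mright (\<gamma> p) x"
  by (metis e_hom mleft_simps(6)) (metis e_hom mright_simps(6))

lemma hom_e_act [simp]: "mleft (\<gamma> p) (mleft e x) = mleft (\<gamma> p) x" "mright e (mright (\<gamma> p) x) = mright (\<gamma> p) x"
  by (metis hom_e mleft_simps(6)) (metis hom_e mright_simps(6))

lemma hom_act: "mleft (\<gamma> p) (mleft (\<gamma> q) x) = mleft (\<gamma> (p * q)) x"
    "mright (\<gamma> q) (mright (\<gamma> p) x) = mright (\<gamma> (p * q)) x"
  by (simp_all add: hom)

lemma left_range_induct [case_names subspace gen]:
  assumes "cvec.subspace {x. P x}" and "\<And>p x. P (mleft (\<gamma> p) x)"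
  shows "P (mleft e x)"
proof -
  have "mleft e x \<in> cvec.span {mleft (\<gamma> p) x | p x. True}" unfolding left_range by blast
  then show ?thesis by (rule cvec.span_induct) (use assms in auto)
qed

lemma right_range_induct [case_names subspace gen]:
  assumes "cvec.subspace {x. P x}" and "\<And>p x. P (mright (\<gamma> p) x)"
  shows "P (mright e x)"
proof -
  have "mright e x \<in> cvec.span {mright (\<gamma> p) x | p x. True}" unfolding right_range by blast
  then show ?thesis by (rule cvec.span_induct) (use assms in auto)
qed

lemma multiplier_determined:
  assumes "m * e = m" "n * e = n" and "\<And>p. m * \<gamma> p = n * \<gamma> p"
  shows "m = n"
proof (rule multiplier_eq_left[OF nondeg])
  fix x
  have "mleft m (mleft e x) = mleft n (mleft e x)"
  proof (induction rule: left_range_induct)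
    case subspace
    then show ?case by (simp add: cvec.subspace_def clinear_zero[OF clinear_mleft])
  next
    case (gen p x)
    then show ?case by (metis assms(3) mleft_simps(6))
  qed
  then show "mleft m x = mleft n x" by (metis assms(1,2) mleft_simps(6))
qed

lemma left_determined:
  assumes "mleft e z = z" "mleft e z' = z'" and eq: "\<And>r. mleft (\<gamma> r) z = mleft (\<gamma> r) z'"
  shows "z = z'"
proof (rule nondegenerate_right[OF nondeg])
  fix u
  have "mright e u * z = mright e u * z'"
  proof (induction rule: right_range_induct)
    case subspace
    then show ?case by (simp add: cvec.subspace_def distrib_right mult_scaleC_left)
  next
    case (gen p x)
    then show ?case by (simp add: multiplier_balance[symmetric] eq)
  qed
  then show "u * z = u * z'" by (simp add: multiplier_balance[symmetric] assms)
qed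

lemma right_determined:
  assumes "mright e z = z" "mright e z' = z'" and eq: "\<And>r. mright (\<gamma> r) z = mright (\<gamma> r) z'"
  shows "z = z'"
proof (rule nondegenerate_left[OF nondeg])
  fix u
  have "z * mleft e u = z' * mleft e u"
  proof (induction rule: left_range_induct)
    case subspace
    then show ?case by (simp add: cvec.subspace_def distrib_left mult_scaleC_right)
  next
    case (gen p x)
    then show ?case by (simp add: multiplier_balance eq)
  qed
  then show "z * u = z' * u" by (simp add: multiplier_balance assms)
qed

text \<open>
  The left action of the extension at \<open>n\<close> has to send \<open>x\<close> to the \<open>z \<in> e Q\<close> with
  \<open>\<gamma>(r) z = \<gamma>(r n) x\<close> for all \<open>r\<close>. There is at most one such \<open>z\<close> by \<open>left_determined\<close>, and on
  a generator \<open>x = \<gamma>(p) y\<close> the element \<open>\<gamma>(n p) y\<close> is one; so no well-definedness argument is needed.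
\<close>

lemma left_action_exists:
  "\<exists>z. mleft e z = z \<and> (\<forall>r. mleft (\<gamma> r) z = mleft (\<gamma> (mright n r)) x)"
proof -
  have "\<exists>z. mleft e z = z \<and> (\<forall>r. mleft (\<gamma> r) z = mleft (\<gamma> (mright n r)) (mleft e x))"
  proof (induction rule: left_range_induct)
    case subspace
    show ?case
      unfolding cvec.subspace_def mem_Collect_eq
      apply (intro conjI ballI allI)
      subgoal by (intro exI[of _ 0]) (simp add: clinear_zero[OF clinear_mleft])
      subgoal by clarsimp (metis multiplier_linear(1))
      subgoal by clarsimp (metis multiplier_linear(2))
      done
  next
    case (gen p y)
    show ?case
      by (intro exI[of _ "mleft (\<gamma> (mleft n p)) y"]) (simp add: hom_act multiplier_balance)
  qed
  then show ?thesis by simp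
qed

lemma right_action_exists:
  "\<exists>z. mright e z = z \<and> (\<forall>r. mright (\<gamma> r) z = mright (\<gamma> (mleft n r)) x)"
proof -
  have "\<exists>z. mright e z = z \<and> (\<forall>r. mright (\<gamma> r) z = mright (\<gamma> (mleft n r)) (mright e x))"
  proof (induction rule: right_range_induct)
    case subspace
    show ?case
      unfolding cvec.subspace_def mem_Collect_eq
      apply (intro conjI ballI allI)
      subgoal by (intro exI[of _ 0]) (simp add: clinear_zero[OF clinear_mright])
      subgoal by clarsimp (metis multiplier_linear(3))
      subgoal by clarsimp (metis multiplier_linear(4))
      done
  next
    case (gen p y)
    show ?case
      by (intro exI[of _ "mright (\<gamma> (mright n p)) y"]) (simp add: hom_act multiplier_balance)
  qed
  then show ?thesis by simp
qed

lemma extension_value_exists: "\<exists>M. M * e = M \<and> (\<forall>p. M * \<gamma> p = \<gamma> (mleft n p))"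
proof -
  obtain L where L: "\<And>x. mleft e (L x) = L x" "\<And>x r. mleft (\<gamma> r) (L x) = mleft (\<gamma> (mright n r)) x"
    using left_action_exists by metis
  obtain R where R: "\<And>x. mright e (R x) = R x" "\<And>x r. mright (\<gamma> r) (R x) = mright (\<gamma> (mleft n r)) x"
    using right_action_exists by metis
  note L_eq = left_determined[OF L(1)] and R_eq = right_determined[OF R(1)]
  have linL: "clinear L"
    unfolding clinear_iff by (intro conjI allI L_eq) (simp_all add: L)
  have linR: "clinear R"
    unfolding clinear_iff by (intro conjI allI R_eq) (simp_all add: R)
  have L_mult: "L (a * b) = L a * b" for a b
    by (rule L_eq) (simp_all add: L mleft_mult)
  have R_mult: "R (a * b) = a * R b" for a b
    by (rule R_eq) (simp_all add: R mright_mult)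
  \<comment> \<open>It suffices to treat the generators \<open>a = x \<gamma>(p)\<close>: there both sides are \<open>x \<gamma>(p n) b\<close>.\<close>
  have "mright e a * L b = R (mright e a) * b" for a b
  proof (induction rule: right_range_induct)
    case subspace
    then show ?case
      by (simp add: cvec.subspace_def distrib_right mult_scaleC_left clinear_add[OF linR] clinear_scale[OF linR] clinear_zero[OF linR])
  next
    case (gen p x)
    have "R (mright (\<gamma> p) x) = mright (\<gamma> (mright n p)) x"
      by (rule R_eq) (simp_all add: R hom_act multiplier_balance)
    then show ?case by (simp add: multiplier_balance[symmetric] L)
  qed
  moreover have "R (mright e a) = R a" for a
    by (rule R_eq) (simp_all add: R)
  ultimately have "a * L b = R a * b" for a b
    by (metis L(1) multiplier_balance)
  with linL linR L_mult R_mult have dc: "double_centralizer L R"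
    by (simp add: double_centralizer_def)
  define M where "M = Abs_multiplier (L, R)"
  have M: "mleft M = L"
    unfolding M_def using dc by (simp add: mleft.rep_eq Abs_multiplier_inverse)
  have "M * e = M"
    by (rule multiplier_eq_left[OF nondeg], simp add: M, rule L_eq) (simp_all add: L)
  moreover have "M * \<gamma> p = \<gamma> (mleft n p)" for p
    by (rule multiplier_eq_left[OF nondeg], simp add: M, rule L_eq) (simp_all add: L hom_act multiplier_balance)
  ultimately show ?thesis by blast
qed

text \<open>
  The equations on the right have a solution \<open>D n\<close> for every \<open>n\<close>, and it is unique. Uniqueness makes
  \<open>D\<close> linear and multiplicative, and every extension satisfies the same equations, so \<open>D\<close> is the
  only one. The criterion turns statements about extended homomorphisms into identities that mention
  \<open>\<gamma>\<close> only.
\<close>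

lemma extension_eq_iff: "extension_to_M \<gamma> e n = M \<longleftrightarrow> M * e = M \<and> (\<forall>p. M * \<gamma> p = \<gamma> (mleft n p))"
proof -
  obtain D where D: "\<And>n. D n * e = D n" "\<And>n p. D n * \<gamma> p = \<gamma> (mleft n p)"
    using extension_value_exists by metis
  note D_eq = multiplier_determined[OF D(1)]
  have "extension_to_M \<gamma> e = D"
    unfolding extension_to_M_def
  proof (rule the_equality, intro conjI allI)
    show "clinear D"
      unfolding clinear_iff
      by (intro conjI allI D_eq)
        (simp_all add: D distrib_right mult_scaleC_left clinear_add[OF lin] clinear_scale[OF lin])
    show "D (m * n) = D m * D n" for m n
      by (rule D_eq) (simp_all add: D mult.assoc)
    show "D (to_M p) = \<gamma> p" for p
      by (rule D_eq) (simp_all add: D hom_e hom)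
    show "D 1 = e"
      by (rule D_eq) (simp_all add: D idem e_hom)
    fix D' assume *: "clinear D' \<and> (\<forall>m n. D' (m * n) = D' m * D' n) \<and> (\<forall>p. D' (to_M p) = \<gamma> p) \<and> D' 1 = e"
    have "D n = D' n" for n
    proof (rule D_eq)
      show "D' n * e = D' n" using * by (metis mult_1_right)
      show "D n * \<gamma> p = D' n * \<gamma> p" for p using * by (metis D(2) mult_to_M)
    qed
    then show "D' = D" by auto
  qed
  then show ?thesis using D D_eq by metis
qed

end

section \<open>The coproduct and its canonical idempotent\<close>

lemma tensor_eq_right_cover:
  fixes t t' :: "'a::complex_alg \<otimes> 'b::complex_alg"
  assumes "nondegenerate_product TYPE('a)" "nondegenerate_product TYPE('b)"
    and eq: "\<And>b. mright (1 \<otimes>\<^sub>m to_M b) t = mright (1 \<otimes>\<^sub>m to_M b) t'"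
  shows "t = t'"
proof (rule nondegenerate_left[OF nondegenerate_tensor[OF assms(1,2)]])
  fix u show "t * u = t' * u"
  proof (induction u rule: tensor_induct)
    case (tensor a b)
    have "t * (a \<otimes>\<^sub>t b) = mright (to_M a \<otimes>\<^sub>m 1) (mright (1 \<otimes>\<^sub>m to_M b) t)" for t :: "'a \<otimes> 'b"
    proof -
      have "mright (to_M a \<otimes>\<^sub>m 1) (mright (1 \<otimes>\<^sub>m to_M b) t) = mright ((1 \<otimes>\<^sub>m to_M b) * (to_M a \<otimes>\<^sub>m 1)) t"
        by simp
      also have "\<dots> = mright (to_M (a \<otimes>\<^sub>t b)) t"
        by (simp only: mtensor_mult to_M_tensor mult_1_left mult_1_right)
      finally show ?thesis by simp
    qed
    then show ?case by (simp add: eq)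
  qed (simp add: distrib_left)
qed

lemma tensor_eq_left_cover:
  fixes t t' :: "'a::complex_alg \<otimes> 'b::complex_alg"
  assumes "nondegenerate_product TYPE('a)" "nondegenerate_product TYPE('b)"
    and eq: "\<And>a. mleft (to_M a \<otimes>\<^sub>m 1) t = mleft (to_M a \<otimes>\<^sub>m 1) t'"
  shows "t = t'"
proof (rule nondegenerate_right[OF nondegenerate_tensor[OF assms(1,2)]])
  fix u show "u * t = u * t'"
  proof (induction u rule: tensor_induct)
    case (tensor a b)
    have "(a \<otimes>\<^sub>t b) * t = mleft (1 \<otimes>\<^sub>m to_M b) (mleft (to_M a \<otimes>\<^sub>m 1) t)" for t :: "'a \<otimes> 'b"
    proof -
      have "mleft (1 \<otimes>\<^sub>m to_M b) (mleft (to_M a \<otimes>\<^sub>m 1) t) = mleft ((1 \<otimes>\<^sub>m to_M b) * (to_M a \<otimes>\<^sub>m 1)) t"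
        by simp
      also have "\<dots> = mleft (to_M (a \<otimes>\<^sub>t b)) t"
        by (simp only: mtensor_mult to_M_tensor mult_1_left mult_1_right)
      finally show ?thesis by simp
    qed
    then show ?case by (simp add: eq)
  qed (simp add: distrib_right)
qed

lemma subspace_range:
  assumes "clinear f"
  shows "cvec.subspace (range f)"
  unfolding cvec.subspace_def
  by (auto simp flip: clinear_add[OF assms] clinear_scale[OF assms] intro: range_eqI[of 0 f 0] simp: clinear_zero[OF assms])

context coproduct
begin

lemmas nondegenerate_sq = nondegenerate_tensor[OF nondegenerate nondegenerate]
lemmas nondegenerate_cube = nondegenerate_tensor[OF nondegenerate_sq nondegenerate]

lemma cancel_right_cover:
  assumes "\<And>b. m * (1 \<otimes>\<^sub>m to_M b) = n * (1 \<otimes>\<^sub>m to_M b)"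
  shows "m = (n :: ('a \<otimes> 'a) multiplier)"
proof (rule multiplier_eq_right[OF nondegenerate_sq])
  fix t show "mright m t = mright n t"
    by (rule tensor_eq_right_cover[OF nondegenerate nondegenerate]) (metis assms mright_simps(6))
qed

lemma cancel_left_cover:
  assumes "\<And>a. (to_M a \<otimes>\<^sub>m 1) * m = (to_M a \<otimes>\<^sub>m 1) * n"
  shows "m = (n :: ('a \<otimes> 'a) multiplier)"
proof (rule multiplier_eq_left[OF nondegenerate_sq])
  fix t show "mleft m t = mleft n t"
    by (rule tensor_eq_left_cover[OF nondegenerate nondegenerate]) (metis assms mleft_simps(6))
qed

lemmas to_M_add = clinear_add[OF clinear_to_M] and to_M_scale = clinear_scale[OF clinear_to_M]
lemmas mtensor_simps = cbilinear_mtensor[unfolded cbilinear_iff, rule_format]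

lemma cbilinear_from_M:
  assumes "\<And>a b. F a b \<in> range (to_M :: 'a \<otimes> 'a \<Rightarrow> _)" "cbilinear F"
  shows "cbilinear (\<lambda>a b. from_M (F a b))"
proof -
  define G where "G a b = from_M (F a b)" for a b
  have G: "to_M (G a b) = F a b" for a b
    unfolding G_def by (rule to_M_from_M[OF assms(1)])
  have "cbilinear G"
    using assms(2) unfolding cbilinear_iff
    by (auto intro!: injD[OF inj_to_M[OF nondegenerate_sq]] simp: G to_M_add to_M_scale)
  then show ?thesis by (simp add: G_def[abs_def])
qed

lemma cbilinear_T1: "cbilinear (\<lambda>a b. from_M (\<Delta> a * (1 \<otimes>\<^sub>m to_M b)))"
  by (rule cbilinear_from_M[OF coprod_right])
    (simp add: cbilinear_iff clinear_add[OF coprod_linear] clinear_scale[OF coprod_linear] distrib_left distrib_right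
      mult_scaleC_left mult_scaleC_right mtensor_simps to_M_add to_M_scale)

lemma cbilinear_T2: "cbilinear (\<lambda>a b. from_M ((to_M a \<otimes>\<^sub>m 1) * \<Delta> b))"
  by (rule cbilinear_from_M[OF coprod_left])
    (simp add: cbilinear_iff clinear_add[OF coprod_linear] clinear_scale[OF coprod_linear] distrib_left distrib_right
      mult_scaleC_left mult_scaleC_right mtensor_simps to_M_add to_M_scale)

lemma clinear_T1: "clinear (T1 \<Delta>)" and T1_tensor: "T1 \<Delta> (a \<otimes>\<^sub>t b) = from_M (\<Delta> a * (1 \<otimes>\<^sub>m to_M b))"
  and clinear_T2: "clinear (T2 \<Delta>)" and T2_tensor: "T2 \<Delta> (a \<otimes>\<^sub>t b) = from_M ((to_M a \<otimes>\<^sub>m 1) * \<Delta> b)"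
  unfolding T1_def T2_def
  by (simp_all add: clinear_tensor_lift tensor_lift_tensor cbilinear_T1 cbilinear_T2)

lemma to_M_T1: "to_M (T1 \<Delta> (a \<otimes>\<^sub>t b)) = \<Delta> a * (1 \<otimes>\<^sub>m to_M b)"
  and to_M_T2: "to_M (T2 \<Delta> (a \<otimes>\<^sub>t b)) = (to_M a \<otimes>\<^sub>m 1) * \<Delta> b"
  by (simp_all add: T1_tensor T2_tensor to_M_from_M coprod_right coprod_left)

lemma T1_mult: "T1 \<Delta> (a \<otimes>\<^sub>t b) * u = mleft (\<Delta> a) (mleft (1 \<otimes>\<^sub>m to_M b) u)"
  by (metis mleft_simps(6) mleft_to_M to_M_T1)

lemma mult_T2: "u * T2 \<Delta> (a \<otimes>\<^sub>t b) = mright (\<Delta> b) (mright (to_M a \<otimes>\<^sub>m 1) u)"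
  by (metis mright_simps(6) mright_to_M to_M_T2)

lemma coprod_T1: "mleft (\<Delta> x) (T1 \<Delta> (a \<otimes>\<^sub>t b)) = T1 \<Delta> ((x * a) \<otimes>\<^sub>t b)"
  by (rule injD[OF inj_to_M[OF nondegenerate_sq]]) (simp add: mult_to_M[symmetric] to_M_T1 coprod_mult mult.assoc)

lemma cbilinear_id_tensor_coprod: "cbilinear (\<lambda>x y. ((to_M x \<otimes>\<^sub>m 1) \<otimes>\<^sub>m 1) * leg23 (\<Delta> y))"
  by (simp add: cbilinear_iff clinear_add[OF coprod_linear] clinear_scale[OF coprod_linear] distrib_left distrib_right
      mult_scaleC_left mult_scaleC_right mtensor_simps to_M_add to_M_scale clinear_add[OF clinear_leg23] clinear_scale[OF clinear_leg23])

lemma clinear_id_tensor_coprod: "clinear (id_tensor_coprod \<Delta>)"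
  and id_tensor_coprod_tensor: "id_tensor_coprod \<Delta> (x \<otimes>\<^sub>t y) = ((to_M x \<otimes>\<^sub>m 1) \<otimes>\<^sub>m 1) * leg23 (\<Delta> y)"
  unfolding id_tensor_coprod_def
  by (simp_all add: clinear_tensor_lift tensor_lift_tensor cbilinear_id_tensor_coprod)

lemma cbilinear_coprod_tensor_id: "cbilinear (\<lambda>x y. \<Delta> x \<otimes>\<^sub>m to_M y)"
  by (simp add: cbilinear_iff clinear_add[OF coprod_linear] clinear_scale[OF coprod_linear] mtensor_simps to_M_add to_M_scale)

lemma clinear_coprod_tensor_id: "clinear (coprod_tensor_id \<Delta>)"
  and coprod_tensor_id_tensor: "coprod_tensor_id \<Delta> (x \<otimes>\<^sub>t y) = \<Delta> x \<otimes>\<^sub>m to_M y"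
  unfolding coprod_tensor_id_def
  by (simp_all add: clinear_tensor_lift tensor_lift_tensor cbilinear_coprod_tensor_id)

lemma id_tensor_coprod_mult: "id_tensor_coprod \<Delta> (v * w) = id_tensor_coprod \<Delta> v * id_tensor_coprod \<Delta> w"
proof (induction v rule: tensor_induct)
  case (tensor a b)
  show ?case
  proof (induction w rule: tensor_induct)
    case (tensor c d)
    have "((to_M (a * c) \<otimes>\<^sub>m 1) \<otimes>\<^sub>m 1) * leg23 (\<Delta> (b * d)) =
      ((to_M a \<otimes>\<^sub>m 1) \<otimes>\<^sub>m 1) * (((to_M c \<otimes>\<^sub>m 1) \<otimes>\<^sub>m 1) * leg23 (\<Delta> b)) * leg23 (\<Delta> d)"
      by (simp add: to_M_mult coprod_mult leg23_mult mtensor_mult mult.assoc[symmetric])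
    then show ?case
      unfolding tensor_times_tensor id_tensor_coprod_tensor
      by (simp only: leg1_leg23_commute[of "to_M c" "\<Delta> b"] mult.assoc)
  qed (simp add: clinear_add[OF clinear_id_tensor_coprod] distrib_left)
qed (simp add: clinear_add[OF clinear_id_tensor_coprod] distrib_right)

end

context weak_multiplier_Hopf_algebra
begin

lemma E_E_act [simp]: "mleft E (mleft E t) = mleft E t" "mright E (mright E t) = mright E t"
  by (metis E_idem mleft_simps(6)) (metis E_idem mright_simps(6))

lemma E_T1: "mleft E (T1 \<Delta> t) = T1 \<Delta> t"
proof -
  have "T1 \<Delta> t \<in> range (mleft E)" unfolding T1_range[symmetric] by simp
  then show ?thesis by auto
qed

lemma T2_E: "mright E (T2 \<Delta> t) = T2 \<Delta> t"
proof -
  have "T2 \<Delta> t \<in> range (mright E)" unfolding T2_range[symmetric] by simp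
  then show ?thesis by auto
qed

lemma E_coprod_left: "E * \<Delta> a = \<Delta> a"
  by (rule cancel_right_cover) (simp add: mult.assoc to_M_T1[symmetric] mult_to_M E_T1)

lemma E_coprod_right: "\<Delta> a * E = \<Delta> a"
  by (rule cancel_left_cover) (simp add: mult.assoc[symmetric] to_M_T2[symmetric] to_M_times T2_E)

lemma span_products: "cvec.span {x * y | x y :: 'a \<otimes> 'a. True} = UNIV"
  using idempotent_tensor[OF idempotent_alg idempotent_alg] by (simp add: idempotent_algebra_def)

text \<open>
  \<open>T1_range\<close> gives \<open>E (A \<otimes> A) = \<Delta>(A)(1 \<otimes> A)\<close>. The missing cover on the first leg comes from
  idempotency: every element of \<open>A \<otimes> A\<close> is a sum of products \<open>x y\<close>, and \<open>E (x y) = (E x) y\<close>.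
\<close>

lemma range_E_left: "cvec.span {mleft (\<Delta> p) w | p w. True} = range (mleft E)"
proof
  have "mleft (\<Delta> p) w \<in> range (mleft E)" for p w
    by (metis E_coprod_left mleft_simps(6) rangeI)
  then show "cvec.span {mleft (\<Delta> p) w | p w. True} \<subseteq> range (mleft E)"
    by (intro cvec.span_minimal subspace_range clinear_mleft clinear_mright) auto
  let ?V = "cvec.span {mleft (\<Delta> p) w | p w. True}"
  have T: "T1 \<Delta> s * y \<in> ?V" for s y
  proof (induction s rule: tensor_induct)
    case (tensor a b)
    then show ?case unfolding T1_mult by (rule cvec.span_base) blast
  qed (simp add: clinear_add[OF clinear_T1] distrib_right cvec.span_add)
  have "mleft E w \<in> ?V" for w
  proof -
    have "w \<in> cvec.span {x * y | x y :: 'a \<otimes> 'a. True}" unfolding span_products by blast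
    then show ?thesis
    proof (induction w rule: cvec.span_induct)
      case base
      then show ?case
        by (auto simp: cvec.subspace_def clinear_zero[OF clinear_mleft] cvec.span_zero intro: cvec.span_add cvec.span_scale)
    next
      case (step w)
      then obtain x y where w: "w = x * y" by blast
      have "mleft E x \<in> range (T1 \<Delta>)" by (simp add: T1_range)
      then show ?case using T by (auto simp: w mleft_mult)
    qed
  qed
  then show "range (mleft E) \<subseteq> ?V" by blast
qed

lemma range_E_right: "cvec.span {mright (\<Delta> p) w | p w. True} = range (mright E)"
proof
  have "mright (\<Delta> p) w \<in> range (mright E)" for p w
    by (metis E_coprod_right mright_simps(6) rangeI)
  then show "cvec.span {mright (\<Delta> p) w | p w. True} \<subseteq> range (mright E)"
    by (intro cvec.span_minimal subspace_range clinear_mleft clinear_mright) auto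
  let ?V = "cvec.span {mright (\<Delta> p) w | p w. True}"
  have T: "y * T2 \<Delta> s \<in> ?V" for s y
  proof (induction s rule: tensor_induct)
    case (tensor a b)
    then show ?case unfolding mult_T2 by (rule cvec.span_base) blast
  qed (simp add: clinear_add[OF clinear_T2] distrib_left cvec.span_add)
  have "mright E w \<in> ?V" for w
  proof -
    have "w \<in> cvec.span {x * y | x y :: 'a \<otimes> 'a. True}" unfolding span_products by blast
    then show ?thesis
    proof (induction w rule: cvec.span_induct)
      case base
      then show ?case
        by (auto simp: cvec.subspace_def clinear_zero[OF clinear_mright] cvec.span_zero intro: cvec.span_add cvec.span_scale)
    next
      case (step w)
      then obtain x y where w: "w = x * y" by blast
      have "mright E y \<in> range (T2 \<Delta>)" by (simp add: T2_range)
      then show ?case using T by (auto simp: w mright_mult)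
    qed
  qed
  then show "range (mright E) \<subseteq> ?V" by blast
qed

lemma nondegenerate_coprod: "nondegenerate_hom \<Delta> E"
  by (rule nondegenerate_hom.intro)
    (rule nondegenerate_sq coprod_linear coprod_mult E_idem range_E_left range_E_right)+

text \<open>
  The factor \<open>E\<close> in the definition of \<open>A\<^sub>t\<close> is absorbed, since \<open>E \<Delta>(p) = \<Delta>(p)\<close>.
\<close>

lemma in_target_algebra_iff: "x \<in> target_algebra \<Delta> E \<longleftrightarrow> (\<forall>p. (x \<otimes>\<^sub>m 1) * \<Delta> p = \<Delta> (mleft x p))"
  unfolding target_algebra_def mem_Collect_eq nondegenerate_hom.extension_eq_iff[OF nondegenerate_coprod]
  by (simp add: mult.assoc E_idem E_coprod_left)

lemma leg23_E_id_tensor_coprod: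
  "leg23 E * id_tensor_coprod \<Delta> v = id_tensor_coprod \<Delta> v" "id_tensor_coprod \<Delta> v * leg23 E = id_tensor_coprod \<Delta> v"
proof -
  have "leg23 E * id_tensor_coprod \<Delta> (x \<otimes>\<^sub>t y) = ((to_M x \<otimes>\<^sub>m 1) \<otimes>\<^sub>m 1) * leg23 (E * \<Delta> y)" for x y
    by (simp only: id_tensor_coprod_tensor leg23_mult mult.assoc[symmetric] leg1_leg23_commute[symmetric])
  then show "leg23 E * id_tensor_coprod \<Delta> v = id_tensor_coprod \<Delta> v"
    by (induction v rule: tensor_induct)
      (simp_all add: E_coprod_left id_tensor_coprod_tensor clinear_add[OF clinear_id_tensor_coprod] distrib_left)
  have "id_tensor_coprod \<Delta> (x \<otimes>\<^sub>t y) * leg23 E = ((to_M x \<otimes>\<^sub>m 1) \<otimes>\<^sub>m 1) * leg23 (\<Delta> y * E)" for x y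
    by (simp add: id_tensor_coprod_tensor leg23_mult mult.assoc)
  then show "id_tensor_coprod \<Delta> v * leg23 E = id_tensor_coprod \<Delta> v"
    by (induction v rule: tensor_induct)
      (simp_all add: E_coprod_right id_tensor_coprod_tensor clinear_add[OF clinear_id_tensor_coprod] distrib_right)
qed


lemma range_leg23_E_left:
  "cvec.span {mleft (id_tensor_coprod \<Delta> v) t | v t. True} = range (mleft (leg23 E))" (is "?V = _")
proof
  have "mleft (id_tensor_coprod \<Delta> v) t \<in> range (mleft (leg23 E))" for v t
    by (metis leg23_E_id_tensor_coprod(1) mleft_simps(6) rangeI)
  then show "?V \<subseteq> range (mleft (leg23 E))"
    by (intro cvec.span_minimal subspace_range clinear_mleft) auto
  have V: "tassoc' (a \<otimes>\<^sub>t z) \<in> ?V" if z: "z \<in> cvec.span {mleft (\<Delta> p) w | p w. True}" for a z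
  proof -
    have "a \<in> cvec.span {x * y | x y. True}"
      using idempotent_alg unfolding idempotent_algebra_def by blast
    then show ?thesis
    proof (induction a rule: cvec.span_induct)
      case base
      then show ?case
        by (auto simp: cvec.subspace_def tensor_simps tassoc'_add clinear_zero[OF clinear_tassoc']
            clinear_scale[OF clinear_tassoc'] cvec.span_zero intro: cvec.span_add cvec.span_scale)
    next
      case (step a)
      then obtain x y where a: "a = x * y" by blast
      from z show ?case
      proof (induction z rule: cvec.span_induct)
        case base
        then show ?case
          by (auto simp: cvec.subspace_def tensor_simps tassoc'_add clinear_zero[OF clinear_tassoc']
              clinear_scale[OF clinear_tassoc'] cvec.span_zero intro: cvec.span_add cvec.span_scale)
      next
        case (step z)
        then obtain p w where "z = mleft (\<Delta> p) w" by blast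
        then have "tassoc' (a \<otimes>\<^sub>t z) = mleft (id_tensor_coprod \<Delta> (x \<otimes>\<^sub>t p)) (tassoc' (y \<otimes>\<^sub>t w))"
          by (simp add: a id_tensor_coprod_tensor leg23_tassoc' mtensor_tassoc')
        then show ?case by (auto intro: cvec.span_base)
      qed
    qed
  qed
  have "mleft (leg23 E) t \<in> ?V" for t
  proof (induction t rule: tensor3_induct)
    case (tensor a b c)
    show ?case unfolding leg23_tensor by (rule V[unfolded range_E_left, OF rangeI])
  next
    case (add x y)
    then show ?case unfolding multiplier_linear by (rule cvec.span_add)
  qed
  then show "range (mleft (leg23 E)) \<subseteq> ?V" by blast
qed

lemma range_leg23_E_right:
  "cvec.span {mright (id_tensor_coprod \<Delta> v) t | v t. True} = range (mright (leg23 E))" (is "?V = _")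
proof
  have "mright (id_tensor_coprod \<Delta> v) t \<in> range (mright (leg23 E))" for v t
    by (metis leg23_E_id_tensor_coprod(2) mright_simps(6) rangeI)
  then show "?V \<subseteq> range (mright (leg23 E))"
    by (intro cvec.span_minimal subspace_range clinear_mright) auto
  have V: "tassoc' (a \<otimes>\<^sub>t z) \<in> ?V" if z: "z \<in> cvec.span {mright (\<Delta> p) w | p w. True}" for a z
  proof -
    have "a \<in> cvec.span {x * y | x y. True}"
      using idempotent_alg unfolding idempotent_algebra_def by blast
    then show ?thesis
    proof (induction a rule: cvec.span_induct)
      case base
      then show ?case
        by (auto simp: cvec.subspace_def tensor_simps tassoc'_add clinear_zero[OF clinear_tassoc']
            clinear_scale[OF clinear_tassoc'] cvec.span_zero intro: cvec.span_add cvec.span_scale)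
    next
      case (step a)
      then obtain x y where a: "a = x * y" by blast
      from z show ?case
      proof (induction z rule: cvec.span_induct)
        case base
        then show ?case
          by (auto simp: cvec.subspace_def tensor_simps tassoc'_add clinear_zero[OF clinear_tassoc']
              clinear_scale[OF clinear_tassoc'] cvec.span_zero intro: cvec.span_add cvec.span_scale)
      next
        case (step z)
        then obtain p w where "z = mright (\<Delta> p) w" by blast
        then have "tassoc' (a \<otimes>\<^sub>t z) = mright (id_tensor_coprod \<Delta> (y \<otimes>\<^sub>t p)) (tassoc' (x \<otimes>\<^sub>t w))"
          by (simp add: a id_tensor_coprod_tensor leg23_tassoc' mtensor_tassoc')
        then show ?case by (auto intro: cvec.span_base)
      qed
    qed
  qed
  have "mright (leg23 E) t \<in> ?V" for t
  proof (induction t rule: tensor3_induct)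
    case (tensor a b c)
    show ?case unfolding leg23_tensor by (rule V[unfolded range_E_right, OF rangeI])
  next
    case (add x y)
    then show ?case unfolding multiplier_linear by (rule cvec.span_add)
  qed
  then show "range (mright (leg23 E)) \<subseteq> ?V" by blast
qed

lemma nondegenerate_id_tensor_coprod: "nondegenerate_hom (id_tensor_coprod \<Delta>) (leg23 E)"
proof -
  have "leg23 E * leg23 E = leg23 E" by (simp flip: leg23_mult add: E_idem)
  then show ?thesis
    by (intro nondegenerate_hom.intro nondegenerate_cube clinear_id_tensor_coprod id_tensor_coprod_mult
      range_leg23_E_left range_leg23_E_right)
qed

text \<open>
  The axiom on \<open>(id \<otimes> \<Delta>)E\<close>, read through \<open>extension_eq_iff\<close>.
\<close>

lemma id_tensor_coprod_E: "leg12 E * leg23 E * id_tensor_coprod \<Delta> v = id_tensor_coprod \<Delta> (mleft E v)"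
  using E_coprod unfolding nondegenerate_hom.extension_eq_iff[OF nondegenerate_id_tensor_coprod] by blast

end

section \<open>Slices of the coproduct in the regular case\<close>

text \<open>
  The canonical map \<open>a \<otimes> b \<mapsto> \<Delta>(b)(a \<otimes> 1)\<close>, with the numbering usual for multiplier Hopf algebras. It
  is meaningful once \<open>\<Delta>(b)(a \<otimes> 1)\<close> is known to lie in \<open>A \<otimes> A\<close>.
\<close>

definition T4 :: "'a::complex_alg coprod \<Rightarrow> 'a \<otimes> 'a \<Rightarrow> 'a \<otimes> 'a"
  where "T4 \<Delta> = tensor_lift (\<lambda>a b. from_M (\<Delta> b * (to_M a \<otimes>\<^sub>m 1)))"

context regular_weak_multiplier_Hopf_algebra
begin

text \<open>
  \<open>R2 (S(d) \<otimes> b) = \<Sum> S(d) S(b\<^sub>(\<^sub>1\<^sub>)) \<otimes> b\<^sub>(\<^sub>2\<^sub>) = \<Sum> S(b\<^sub>(\<^sub>1\<^sub>) d) \<otimes> b\<^sub>(\<^sub>2\<^sub>)\<close> lies in \<open>A \<otimes> A\<close>; undoing \<open>S\<close> on the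
  first leg gives \<open>\<Delta>(b)(d \<otimes> 1)\<close>.
\<close>

lemma coprod_first_cover: "\<Delta> b * (to_M d \<otimes>\<^sub>m 1) \<in> range to_M"
proof -
  obtain R2 where R2: "antipode_R2 \<Delta> S R2" and S_lin: "clinear S" and S_anti: "\<And>a b. S (a * b) = S b * S a"
    using antipode unfolding antipode_def by blast
  define \<sigma> where "\<sigma> a = from_M (S a)" for a
  have \<sigma>: "S a = to_M (\<sigma> a)" for a
    unfolding \<sigma>_def using antipode_bij by (intro to_M_from_M[symmetric]) (auto simp: bij_betw_def)
  note inj = injD[OF inj_to_M[OF nondegenerate]]
  have \<sigma>_lin: "clinear \<sigma>"
    unfolding clinear_iff
    by (intro conjI allI inj)
      (simp_all add: \<sigma>[symmetric] to_M_add to_M_scale clinear_add[OF S_lin] clinear_scale[OF S_lin])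
  have \<sigma>_anti: "\<sigma> (a * b) = \<sigma> b * \<sigma> a" for a b
    by (rule inj) (simp add: to_M_mult \<sigma>[symmetric] S_anti)
  have "inj \<sigma>" using antipode_bij unfolding bij_betw_def inj_on_def by (metis \<sigma>)
  have "surj \<sigma>" unfolding surj_def
  proof
    fix x have "to_M x \<in> range S" using antipode_bij by (simp add: bij_betw_def)
    then show "\<exists>a. x = \<sigma> a" using \<sigma> inj by (metis rangeE)
  qed
  define \<tau> where "\<tau> = inv \<sigma>"
  have \<sigma>\<tau>: "\<sigma> (\<tau> x) = x" and \<tau>\<sigma>: "\<tau> (\<sigma> x) = x" for x
    unfolding \<tau>_def by (simp_all add: surj_f_inv_f \<open>surj \<sigma>\<close> \<open>inj \<sigma>\<close>)
  have \<tau>_lin: "clinear \<tau>"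
    unfolding clinear_iff
    by (metis \<sigma>\<tau> \<tau>\<sigma> clinear_add[OF \<sigma>_lin] clinear_scale[OF \<sigma>_lin])
  let ?\<sigma> = "tensor_map \<sigma> (\<lambda>x::'a. x)" and ?\<tau> = "tensor_map \<tau> (\<lambda>x::'a. x)"
  note map = tensor_map_tensor tensor_map_add \<sigma>_lin \<tau>_lin clinear_id
  have \<tau>\<sigma>_map: "?\<tau> (?\<sigma> t) = t" for t
    by (induction t rule: tensor_induct) (simp_all add: map \<tau>\<sigma>)
  have S_map: "tensor_lift (\<lambda>p q. S p \<otimes>\<^sub>m to_M q) t = to_M (?\<sigma> t)" for t :: "'a \<otimes> 'a"
  proof -
    have bil: "cbilinear (\<lambda>p q::'a. to_M (\<sigma> p) \<otimes>\<^sub>m to_M q)"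
      by (simp add: cbilinear_iff clinear_add[OF \<sigma>_lin] clinear_scale[OF \<sigma>_lin] mtensor_simps to_M_add to_M_scale)
    show ?thesis
      unfolding \<sigma>
      by (induction t rule: tensor_induct)
        (simp_all add: map tensor_lift_tensor[OF bil] clinear_add[OF clinear_tensor_lift[OF bil]] to_M_tensor
          clinear_add[OF clinear_to_M])
  qed
  have \<sigma>_act: "mleft (to_M (\<sigma> d) \<otimes>\<^sub>m 1) (?\<sigma> t) = ?\<sigma> (mright (to_M d \<otimes>\<^sub>m 1) t)" for t
    by (induction t rule: tensor_induct) (simp_all add: map \<sigma>_anti)
  have "\<Delta> b * (to_M d \<otimes>\<^sub>m 1) = to_M (?\<tau> (R2 (\<sigma> d \<otimes>\<^sub>t b)))"
  proof (rule cancel_right_cover)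
    fix c
    have "to_M (mright (1 \<otimes>\<^sub>m to_M c) (R2 (\<sigma> d \<otimes>\<^sub>t b))) = to_M (?\<sigma> (mright (to_M d \<otimes>\<^sub>m 1) (T1 \<Delta> (b \<otimes>\<^sub>t c))))"
      using R2 unfolding antipode_R2_def S_map T1_tensor[symmetric]
      by (simp add: to_M_times[symmetric] mult_to_M \<sigma>_act)
    then have "mright (1 \<otimes>\<^sub>m to_M c) (R2 (\<sigma> d \<otimes>\<^sub>t b)) = ?\<sigma> (mright (to_M d \<otimes>\<^sub>m 1) (T1 \<Delta> (b \<otimes>\<^sub>t c)))"
      by (rule injD[OF inj_to_M[OF nondegenerate_sq]])
    then have "?\<tau> (mright (1 \<otimes>\<^sub>m to_M c) (R2 (\<sigma> d \<otimes>\<^sub>t b))) = mright (to_M d \<otimes>\<^sub>m 1) (T1 \<Delta> (b \<otimes>\<^sub>t c))"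
      by (simp add: \<tau>\<sigma>_map)
    then have "to_M (?\<tau> (R2 (\<sigma> d \<otimes>\<^sub>t b))) * (1 \<otimes>\<^sub>m to_M c) = to_M (T1 \<Delta> (b \<otimes>\<^sub>t c)) * (to_M d \<otimes>\<^sub>m 1)"
      by (simp add: to_M_times tensor_map_act_second \<tau>_lin)
    then show "\<Delta> b * (to_M d \<otimes>\<^sub>m 1) * (1 \<otimes>\<^sub>m to_M c) = to_M (?\<tau> (R2 (\<sigma> d \<otimes>\<^sub>t b))) * (1 \<otimes>\<^sub>m to_M c)"
      by (simp add: to_M_T1 mult.assoc mtensor_mult)
  qed
  then show ?thesis by simp
qed

lemma cbilinear_T4: "cbilinear (\<lambda>a b. from_M (\<Delta> b * (to_M a \<otimes>\<^sub>m 1)))"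
  by (rule cbilinear_from_M[OF coprod_first_cover])
    (simp add: cbilinear_iff clinear_add[OF coprod_linear] clinear_scale[OF coprod_linear] distrib_left distrib_right
      mult_scaleC_left mult_scaleC_right mtensor_simps to_M_add to_M_scale)

lemma clinear_T4: "clinear (T4 \<Delta>)" and T4_tensor: "T4 \<Delta> (a \<otimes>\<^sub>t b) = from_M (\<Delta> b * (to_M a \<otimes>\<^sub>m 1))"
  unfolding T4_def by (simp_all add: clinear_tensor_lift tensor_lift_tensor cbilinear_T4)

lemma to_M_T4: "to_M (T4 \<Delta> (a \<otimes>\<^sub>t b)) = \<Delta> b * (to_M a \<otimes>\<^sub>m 1)"
  by (simp add: T4_tensor to_M_from_M coprod_first_cover)

lemmas to_M_sq_eqD = injD[OF inj_to_M[OF nondegenerate_sq]]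

text \<open>
  The two prescribed actions are compatible because both sides of \<open>x (y\<^sub>a z) = (x y\<^sub>a) z\<close> are slices of
  \<open>(x \<otimes> 1)\<Delta>(a)(z \<otimes> 1)\<close>; hence
  the multiplier \<open>y\<^sub>a = (id \<otimes> f)\<Delta>(a)\<close> exists.
\<close>

lemma coprod_slice_act:
  assumes f: "clinear f"
  shows "mleft (coprod_slice \<Delta> f a) b = slice2 f (T4 \<Delta> (b \<otimes>\<^sub>t a))"
    and "mright (coprod_slice \<Delta> f a) b = slice2 f (T2 \<Delta> (b \<otimes>\<^sub>t a))"
proof -
  define L where "L b = slice2 f (T4 \<Delta> (b \<otimes>\<^sub>t a))" for b
  define R where "R b = slice2 f (T2 \<Delta> (b \<otimes>\<^sub>t a))" for b
  have "clinear L" "clinear R"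
    unfolding L_def R_def clinear_iff
    by (simp_all add: tensor_simps clinear_add[OF clinear_T4] clinear_add[OF clinear_T2] clinear_add[OF clinear_slice2[OF f]]
      clinear_scale[OF clinear_T4] clinear_scale[OF clinear_T2] clinear_scale[OF clinear_slice2[OF f]])
  moreover have "L (x * y) = L x * y" for x y
  proof -
    have "T4 \<Delta> ((x * y) \<otimes>\<^sub>t a) = mright (to_M y \<otimes>\<^sub>m 1) (T4 \<Delta> (x \<otimes>\<^sub>t a))"
      by (rule to_M_sq_eqD) (simp add: to_M_T4 to_M_times[symmetric] mult.assoc mtensor_mult to_M_mult)
    then show ?thesis by (simp add: L_def slice2_act f)
  qed
  moreover have "R (x * y) = x * R y" for x y
  proof -
    have "T2 \<Delta> ((x * y) \<otimes>\<^sub>t a) = mleft (to_M x \<otimes>\<^sub>m 1) (T2 \<Delta> (y \<otimes>\<^sub>t a))"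
      by (rule to_M_sq_eqD) (simp add: to_M_T2 mult_to_M[symmetric] mult.assoc[symmetric] mtensor_mult to_M_mult)
    then show ?thesis by (simp add: R_def slice2_act f)
  qed
  moreover have "x * L y = R x * y" for x y
  proof -
    have "mleft (to_M x \<otimes>\<^sub>m 1) (T4 \<Delta> (y \<otimes>\<^sub>t a)) = mright (to_M y \<otimes>\<^sub>m 1) (T2 \<Delta> (x \<otimes>\<^sub>t a))"
      by (rule to_M_sq_eqD) (simp add: to_M_T2 to_M_T4 mult_to_M[symmetric] to_M_times[symmetric] mult.assoc)
    then have "slice2 f (mleft (to_M x \<otimes>\<^sub>m 1) (T4 \<Delta> (y \<otimes>\<^sub>t a))) = slice2 f (mright (to_M y \<otimes>\<^sub>m 1) (T2 \<Delta> (x \<otimes>\<^sub>t a)))"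
      by simp
    then show ?thesis by (simp add: L_def R_def slice2_act f)
  qed
  ultimately have "double_centralizer L R" by (simp add: double_centralizer_def)
  then obtain x where x: "mleft x = L" "mright x = R"
    by (metis Abs_multiplier_inverse case_prodI fst_conv mem_Collect_eq mleft.rep_eq mright.rep_eq snd_conv)
  have "coprod_slice \<Delta> f a = x"
    unfolding coprod_slice_def right_slice_eq_slice2 T4_tensor[symmetric] T2_tensor[symmetric]
    by (rule the_equality) (auto simp: x L_def R_def intro: multiplier_eqI)
  then show "mleft (coprod_slice \<Delta> f a) b = slice2 f (T4 \<Delta> (b \<otimes>\<^sub>t a))"
    "mright (coprod_slice \<Delta> f a) b = slice2 f (T2 \<Delta> (b \<otimes>\<^sub>t a))"
    by (simp_all add: x L_def R_def)
qed

lemma clinear_coprod_slice: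
  assumes "clinear f"
  shows "clinear (coprod_slice \<Delta> f)"
  unfolding clinear_iff
  by (intro conjI allI multiplier_eqI)
    (simp_all add: coprod_slice_act[OF assms] tensor_simps clinear_add[OF clinear_T4] clinear_add[OF clinear_T2]
      clinear_add[OF clinear_slice2[OF assms]]
      clinear_scale[OF clinear_T4] clinear_scale[OF clinear_T2] clinear_scale[OF clinear_slice2[OF assms]])

lemma clinear_coprod_slice_act:
  assumes "clinear f"
  shows "clinear (\<lambda>q. mleft (coprod_slice \<Delta> f q) d)"
  using clinear_coprod_slice[OF assms] by (simp add: clinear_iff)

end

section \<open>Slices of the coproduct in the target algebra\<close>

context regular_weak_multiplier_Hopf_algebra
begin

text \<open>
  \<open>id_T4 t w\<close> is \<open>(id \<otimes> \<Delta>)(t)(w \<otimes> 1)\<close>. Covering the first two legs keeps it in \<open>A \<otimes> A \<otimes> A\<close> and leaves the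
  third leg free, so that an arbitrary functional can be applied there.
\<close>

definition id_T4 :: "'a \<otimes> 'a \<Rightarrow> 'a \<otimes> 'a \<Rightarrow> ('a \<otimes> 'a) \<otimes> 'a"
  where "id_T4 t w = tensor_lift (\<lambda>p q. tensor_lift (\<lambda>r d. tassoc' ((p * r) \<otimes>\<^sub>t T4 \<Delta> (d \<otimes>\<^sub>t q))) w) t"

lemma
  shows clinear_id_T4_left: "clinear (\<lambda>t. id_T4 t w)" and clinear_id_T4_right: "clinear (id_T4 t)"
    and id_T4_tensor: "id_T4 (p \<otimes>\<^sub>t q) (r \<otimes>\<^sub>t d) = tassoc' ((p * r) \<otimes>\<^sub>t T4 \<Delta> (d \<otimes>\<^sub>t q))"
proof -
  let ?F = "\<lambda>(p::'a) q (r::'a) d. tassoc' ((p * r) \<otimes>\<^sub>t T4 \<Delta> (d \<otimes>\<^sub>t q))"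
  have 1: "cbilinear (?F p q)" and 2: "cbilinear (\<lambda>p q. ?F p q r d)" for p q r d
    by (simp_all add: cbilinear_iff tensor_simps distrib_left distrib_right mult_scaleC_left mult_scaleC_right
        clinear_add[OF clinear_T4] clinear_scale[OF clinear_T4] tassoc'_add clinear_scale[OF clinear_tassoc'])
  have 3: "cbilinear (\<lambda>p q. tensor_lift (?F p q) w)" for w
    by (rule cbilinear_lift_params[OF 1 2])
  show "clinear (\<lambda>t. id_T4 t w)"
    unfolding id_T4_def by (rule clinear_tensor_lift[OF 3])
  show pure: "id_T4 (p \<otimes>\<^sub>t q) (r \<otimes>\<^sub>t d) = ?F p q r d" for p q r d
    unfolding id_T4_def by (simp add: tensor_lift_tensor[OF 2] tensor_lift_tensor[OF 1])
  note add = clinear_add[OF \<open>clinear (\<lambda>t. id_T4 t _)\<close>]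
  show "clinear (id_T4 t)"
  proof (induction t rule: tensor_induct)
    case (tensor p q)
    have "id_T4 (p \<otimes>\<^sub>t q) = tensor_lift (?F p q)"
      by (simp add: fun_eq_iff id_T4_def tensor_lift_tensor[OF 3])
    then show ?case by (simp add: clinear_tensor_lift[OF 1])
  next
    case (add x y)
    have "clinear (\<lambda>t. id_T4 t w)" for w
      unfolding id_T4_def by (rule clinear_tensor_lift[OF 3])
    then have "id_T4 (x + y) = (\<lambda>w. id_T4 x w + id_T4 y w)"
      by (simp add: fun_eq_iff clinear_add[of "\<lambda>t. id_T4 t _"])
    with add show ?case by (simp add: clinear_iff scaleC_add_right)
  qed
qed

lemmas id_T4_add = clinear_add[OF clinear_id_T4_left] clinear_add[OF clinear_id_T4_right]

lemma id_tensor_coprod_act: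
  "mleft (id_tensor_coprod \<Delta> t) (w \<otimes>\<^sub>t c) = mright (1 \<otimes>\<^sub>m to_M c) (id_T4 t w)"
proof (induction t rule: tensor_induct)
  case (tensor p q)
  show ?case
  proof (induction w rule: tensor_induct)
    case (tensor r d)
    have "mleft (\<Delta> q) (d \<otimes>\<^sub>t c) = mright (1 \<otimes>\<^sub>m to_M c) (T4 \<Delta> (d \<otimes>\<^sub>t q))"
      by (rule to_M_sq_eqD)
        (simp add: mult_to_M[symmetric] to_M_times[symmetric] to_M_T4 mult.assoc mtensor_mult to_M_tensor)
    then show ?case
      by (simp add: id_tensor_coprod_tensor id_T4_tensor mtensor_tassoc' tassoc'_act_third)
  qed (simp add: id_T4_add tensor_simps)
qed (simp add: id_T4_add clinear_add[OF clinear_id_tensor_coprod])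

text \<open>
  Coassociativity of \<open>\<Delta>\<close> on \<open>(b \<otimes> 1)\<Delta>(h)\<close>. The axiom comes with a cover \<open>c\<close> on the third leg,
  and a second cover \<open>c'\<close> is needed to evaluate both multipliers on an element; \<open>eq_by_third_covers\<close>
  removes them afterwards.
\<close>

lemma id_T4_coassoc:
  "mright (1 \<otimes>\<^sub>m to_M (c * c')) (id_T4 (T2 \<Delta> (b \<otimes>\<^sub>t h)) w) =
   mleft ((to_M b \<otimes>\<^sub>m 1) \<otimes>\<^sub>m 1) (mleft (coprod_tensor_id \<Delta> (T1 \<Delta> (h \<otimes>\<^sub>t c))) (w \<otimes>\<^sub>t c'))"
proof -
  have "mright (1 \<otimes>\<^sub>m to_M (c * c')) (id_T4 (T2 \<Delta> (b \<otimes>\<^sub>t h)) w) =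
      mleft (id_tensor_coprod \<Delta> (T2 \<Delta> (b \<otimes>\<^sub>t h)) * ((1 \<otimes>\<^sub>m 1) \<otimes>\<^sub>m to_M c)) (w \<otimes>\<^sub>t c')"
    unfolding id_tensor_coprod_act[symmetric] by simp
  also have "\<dots> = mleft (((to_M b \<otimes>\<^sub>m 1) \<otimes>\<^sub>m 1) * coprod_tensor_id \<Delta> (T1 \<Delta> (h \<otimes>\<^sub>t c))) (w \<otimes>\<^sub>t c')"
    unfolding T1_tensor T2_tensor coassoc ..
  finally show ?thesis by simp
qed

lemma eq_by_third_covers:
  fixes t t' :: "('a \<otimes> 'a) \<otimes> 'a"
  assumes "\<And>c c'. mright (1 \<otimes>\<^sub>m to_M (c * c')) t = mright (1 \<otimes>\<^sub>m to_M (c * c')) t'"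
  shows "t = t'"
proof (rule tensor_eq_right_cover[OF nondegenerate_sq nondegenerate])
  have split: "mright (1 \<otimes>\<^sub>m to_M (c * c')) t = mright (1 \<otimes>\<^sub>m to_M c') (mright (1 \<otimes>\<^sub>m to_M c) t)" for c c' and t :: "('a \<otimes> 'a) \<otimes> 'a"
  proof -
    have "mright (1 \<otimes>\<^sub>m to_M c') (mright (1 \<otimes>\<^sub>m to_M c) t) = mright ((1 \<otimes>\<^sub>m to_M c) * (1 \<otimes>\<^sub>m to_M c')) t"
      by simp
    also have "\<dots> = mright (1 \<otimes>\<^sub>m to_M (c * c')) t" by (simp only: mtensor_mult to_M_mult mult_1_left)
    finally show ?thesis ..
  qed
  fix c show "mright (1 \<otimes>\<^sub>m to_M c) t = mright (1 \<otimes>\<^sub>m to_M c) t'"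
    by (rule tensor_eq_right_cover[OF nondegenerate_sq nondegenerate]) (simp add: split[symmetric] assms)
qed

text \<open>
  By coassociativity the first two legs of \<open>(id \<otimes> \<Delta>)((b \<otimes> 1)\<Delta>(h))\<close> are of the form \<open>\<Delta>(x)\<close> up to
  the factor \<open>b\<close>, and \<open>\<Delta>(x) E = \<Delta>(x)\<close>.
\<close>

lemma id_T4_E: "id_T4 (T2 \<Delta> (b \<otimes>\<^sub>t h)) (mleft E w) = id_T4 (T2 \<Delta> (b \<otimes>\<^sub>t h)) w"
proof (rule eq_by_third_covers)
  have "mleft (\<Delta> x) (mleft E w) = mleft (\<Delta> x) w" for x
    by (metis E_coprod_right mleft_simps(6))
  then have "mleft (coprod_tensor_id \<Delta> v) (mleft E w \<otimes>\<^sub>t c') = mleft (coprod_tensor_id \<Delta> v) (w \<otimes>\<^sub>t c')" for v c'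
    by (induction v rule: tensor_induct)
      (simp_all add: coprod_tensor_id_tensor clinear_add[OF clinear_coprod_tensor_id])
  then show "mright (1 \<otimes>\<^sub>m to_M (c * c')) (id_T4 (T2 \<Delta> (b \<otimes>\<^sub>t h)) (mleft E w)) =
     mright (1 \<otimes>\<^sub>m to_M (c * c')) (id_T4 (T2 \<Delta> (b \<otimes>\<^sub>t h)) w)" for c c'
    unfolding id_T4_coassoc by simp
qed

lemma clinear_T1_left: "clinear (\<lambda>x. T1 \<Delta> (x \<otimes>\<^sub>t q))"
  by (simp add: clinear_iff tensor_simps clinear_add[OF clinear_T1] clinear_scale[OF clinear_T1])

text \<open>
  For the element \<open>w = \<Delta>(p)(1 \<otimes> q)\<close>, multiplicativity of \<open>\<Delta>\<close> turns
  \<open>(b \<otimes> 1 \<otimes> 1)(\<Delta> \<otimes> id)(\<Delta>(h))(w \<otimes> 1)\<close> into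
  \<open>(b \<otimes> 1 \<otimes> 1)(\<Delta> \<otimes> id)(\<Delta>(h)(p \<otimes> 1))(1 \<otimes> q \<otimes> 1)\<close>, whose third leg is not covered.
\<close>

lemma id_T4_T1:
  "id_T4 (T2 \<Delta> (b \<otimes>\<^sub>t h)) (T1 \<Delta> (p \<otimes>\<^sub>t q)) =
   tensor_map (\<lambda>x. mleft (to_M b \<otimes>\<^sub>m 1) (T1 \<Delta> (x \<otimes>\<^sub>t q))) (\<lambda>y. y) (T4 \<Delta> (p \<otimes>\<^sub>t h))"
proof (rule eq_by_third_covers)
  fix c c'
  let ?f = "\<lambda>x. mleft (to_M b \<otimes>\<^sub>m 1) (T1 \<Delta> (x \<otimes>\<^sub>t q))"
  have f: "clinear ?f"
    by (rule clinear_comp[OF clinear_mleft clinear_T1_left])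
  have "mleft ((to_M b \<otimes>\<^sub>m 1) \<otimes>\<^sub>m 1) (mleft (coprod_tensor_id \<Delta> v) (T1 \<Delta> (p \<otimes>\<^sub>t q) \<otimes>\<^sub>t c')) =
      tensor_map ?f (\<lambda>y. y) (mright (to_M p \<otimes>\<^sub>m to_M c') v)" for v
    by (induction v rule: tensor_induct)
      (simp_all add: coprod_tensor_id_tensor clinear_add[OF clinear_coprod_tensor_id] coprod_T1
        tensor_map_tensor tensor_map_add f clinear_id)
  moreover have "mright (to_M p \<otimes>\<^sub>m to_M c') (T1 \<Delta> (h \<otimes>\<^sub>t c)) = mright (1 \<otimes>\<^sub>m to_M (c * c')) (T4 \<Delta> (p \<otimes>\<^sub>t h))"
    by (rule to_M_sq_eqD)
      (simp add: to_M_times[symmetric] to_M_T1 to_M_T4 mult.assoc mtensor_mult to_M_mult)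
  ultimately show "mright (1 \<otimes>\<^sub>m to_M (c * c')) (id_T4 (T2 \<Delta> (b \<otimes>\<^sub>t h)) (T1 \<Delta> (p \<otimes>\<^sub>t q))) =
      mright (1 \<otimes>\<^sub>m to_M (c * c')) (tensor_map ?f (\<lambda>y. y) (T4 \<Delta> (p \<otimes>\<^sub>t h)))"
    unfolding id_T4_coassoc by (simp add: tensor_map_act_second f)
qed

context
  fixes \<phi> :: "'a \<Rightarrow> complex" and h b :: 'a
  assumes \<phi>: "clinear \<phi>" and h: "coprod_slice \<Delta> \<phi> h \<in> target_algebra \<Delta> E"
begin

definition covered_value :: "'a multiplier" where "covered_value = to_M b * coprod_slice \<Delta> \<phi> h"

text \<open>
  For \<open>(b \<otimes> 1)\<Delta>(h) = \<Sum> p\<^sub>i \<otimes> q\<^sub>i\<close> this is \<open>\<Sum> p\<^sub>i \<otimes> ((id \<otimes> \<phi>)\<Delta>(q\<^sub>i)) d\<close>. It represents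
  \<open>(b y\<^sub>h \<otimes> 1)E(1 \<otimes> d)\<close>, where \<open>b y\<^sub>h = covered_value\<close>, by \<open>covered_E_cover\<close>.
\<close>

definition covered_E :: "'a \<Rightarrow> 'a \<otimes> 'a"
  where "covered_E d = tensor_map (\<lambda>x. x) (\<lambda>q. mleft (coprod_slice \<Delta> \<phi> q) d) (T2 \<Delta> (b \<otimes>\<^sub>t h))"

text \<open>
  The hypothesis that \<open>y\<^sub>h = (id \<otimes> \<phi>)\<Delta>(h)\<close> lies in \<open>A\<^sub>t\<close> enters here: slicing \<open>id_T4_T1\<close> gives \<open>(b \<otimes> 1)\<Delta>(y\<^sub>h p)(1 \<otimes> q)\<close>, which is
  \<open>(b y\<^sub>h \<otimes> 1)\<Delta>(p)(1 \<otimes> q)\<close>. As the elements \<open>\<Delta>(p)(1 \<otimes> q)\<close> span \<open>E (A \<otimes> A)\<close> and \<open>w\<close> may be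
  replaced by \<open>E w\<close> by \<open>id_T4_E\<close>, this gives the formula for all \<open>w\<close>.
\<close>

lemma slice2_id_T4: "slice2 \<phi> (id_T4 (T2 \<Delta> (b \<otimes>\<^sub>t h)) w) = mleft (covered_value \<otimes>\<^sub>m 1) (mleft E w)"
proof -
  have "slice2 \<phi> (id_T4 (T2 \<Delta> (b \<otimes>\<^sub>t h)) (T1 \<Delta> s)) = mleft (covered_value \<otimes>\<^sub>m 1) (T1 \<Delta> s)" for s
  proof (induction s rule: tensor_induct)
    case (tensor p q)
    let ?y = "coprod_slice \<Delta> \<phi> h"
    have "T1 \<Delta> (mleft ?y p \<otimes>\<^sub>t q) = mleft (?y \<otimes>\<^sub>m 1) (T1 \<Delta> (p \<otimes>\<^sub>t q))"
      using h unfolding in_target_algebra_iff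
      by (intro to_M_sq_eqD) (simp add: to_M_T1 mult_to_M[symmetric] mult.assoc[symmetric])
    moreover have "(to_M b \<otimes>\<^sub>m 1) * (?y \<otimes>\<^sub>m 1) = covered_value \<otimes>\<^sub>m (1 :: 'a multiplier)"
      by (simp add: mtensor_mult covered_value_def)
    ultimately have "mleft (to_M b \<otimes>\<^sub>m 1) (T1 \<Delta> (mleft ?y p \<otimes>\<^sub>t q)) = mleft (covered_value \<otimes>\<^sub>m 1) (T1 \<Delta> (p \<otimes>\<^sub>t q))"
      by (metis mleft_simps(6))
    then show ?case
      unfolding id_T4_T1 slice2_tensor_map[OF \<phi> clinear_comp[OF clinear_mleft clinear_T1_left]]
      by (simp add: coprod_slice_act[OF \<phi>])
  qed (simp add: clinear_add[OF clinear_T1] id_T4_add clinear_add[OF clinear_slice2[OF \<phi>]])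
  moreover have "mleft E w \<in> range (T1 \<Delta>)" by (simp add: T1_range)
  ultimately show ?thesis by (metis id_T4_E rangeE)
qed

lemma clinear_covered_E: "clinear covered_E"
proof -
  note lin = clinear_coprod_slice_act[OF \<phi>]
  have "clinear (\<lambda>d. tensor_map (\<lambda>x. x) (\<lambda>q. mleft (coprod_slice \<Delta> \<phi> q) d) t)" for t :: "'a \<otimes> 'a"
  proof (induction t rule: tensor_induct)
    case (tensor a c)
    show ?case by (simp add: tensor_map_tensor lin clinear_id clinear_iff[of "\<lambda>d. a \<otimes>\<^sub>t mleft _ d"] tensor_simps)
  next
    case (add x y)
    then show ?case
      unfolding tensor_map_add[OF clinear_id lin] by (rule clinear_add_fun)
  qed
  then show ?thesis unfolding covered_E_def[abs_def] .
qed

lemma covered_E_cover: "mright (to_M r \<otimes>\<^sub>m 1) (covered_E d) = mleft (covered_value \<otimes>\<^sub>m 1) (mleft E (r \<otimes>\<^sub>t d))"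
proof -
  note lin = clinear_coprod_slice_act[OF \<phi>]
  have "slice2 \<phi> (id_T4 t (r \<otimes>\<^sub>t d)) =
      mright (to_M r \<otimes>\<^sub>m 1) (tensor_map (\<lambda>x. x) (\<lambda>q. mleft (coprod_slice \<Delta> \<phi> q) d) t)" for t
    by (induction t rule: tensor_induct)
      (simp_all add: id_T4_tensor id_T4_add slice2_tassoc' \<phi> clinear_add[OF clinear_slice2[OF \<phi>]]
        tensor_map_tensor tensor_map_add lin clinear_id flip: coprod_slice_act(1)[OF \<phi>])
  then show ?thesis by (simp add: covered_E_def flip: slice2_id_T4)
qed

lemma covered_E_mult: "covered_E d * (r \<otimes>\<^sub>t s) = mleft (covered_value \<otimes>\<^sub>m 1) (mleft E (r \<otimes>\<^sub>t (d * s)))"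
proof -
  have "covered_E d * (r \<otimes>\<^sub>t s) = mright (to_M (r \<otimes>\<^sub>t s)) (covered_E d)" by simp
  also have "to_M (r \<otimes>\<^sub>t s) = (to_M r \<otimes>\<^sub>m 1) * (1 \<otimes>\<^sub>m to_M s)" by (simp add: mtensor_mult to_M_tensor)
  also have "mright \<dots> (covered_E d) = mright (1 \<otimes>\<^sub>m to_M s) (mleft (covered_value \<otimes>\<^sub>m 1) (mleft E (r \<otimes>\<^sub>t d)))"
    by (simp add: covered_E_cover)
  also have "\<dots> = mleft (covered_value \<otimes>\<^sub>m 1) (mleft E (r \<otimes>\<^sub>t (d * s)))"
    by (simp add: mleft_mright_commute[OF nondegenerate_sq])
  finally show ?thesis .
qed

text \<open>
  Formally, this is \<open>(id \<otimes> \<Delta>)\<close> applied to \<open>(b y\<^sub>h \<otimes> 1)E(1 \<otimes> d)\<close>. Multiplying by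
  \<open>(id \<otimes> \<Delta>)(v)\<close> on the right reduces it to the known value of \<open>id \<otimes> \<Delta>\<close> on elements of the form \<open>E v\<close>.
\<close>

lemma id_tensor_coprod_covered_E: "id_tensor_coprod \<Delta> (covered_E d) = ((covered_value \<otimes>\<^sub>m 1) \<otimes>\<^sub>m 1) * leg12 E * leg23 (\<Delta> d)"
proof (rule nondegenerate_hom.multiplier_determined[OF nondegenerate_id_tensor_coprod])
  show "id_tensor_coprod \<Delta> (covered_E d) * leg23 E = id_tensor_coprod \<Delta> (covered_E d)"
    by (rule leg23_E_id_tensor_coprod)
  show "((covered_value \<otimes>\<^sub>m 1) \<otimes>\<^sub>m 1) * leg12 E * leg23 (\<Delta> d) * leg23 E = ((covered_value \<otimes>\<^sub>m 1) \<otimes>\<^sub>m 1) * leg12 E * leg23 (\<Delta> d)"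
    by (simp add: mult.assoc leg23_mult[symmetric] E_coprod_right)
  have act_value: "id_tensor_coprod \<Delta> (mleft (covered_value \<otimes>\<^sub>m 1) v) = ((covered_value \<otimes>\<^sub>m 1) \<otimes>\<^sub>m 1) * id_tensor_coprod \<Delta> v" for v
    by (induction v rule: tensor_induct)
      (simp_all add: id_tensor_coprod_tensor clinear_add[OF clinear_id_tensor_coprod] distrib_left
        mult_to_M[symmetric] mult.assoc[symmetric] mtensor_mult)
  have d: "id_tensor_coprod \<Delta> (r \<otimes>\<^sub>t (d * s)) = leg23 (\<Delta> d) * id_tensor_coprod \<Delta> (r \<otimes>\<^sub>t s)" for r s
    by (simp only: id_tensor_coprod_tensor coprod_mult leg23_mult mult.assoc[symmetric]
        leg1_leg23_commute[of "to_M r" "\<Delta> d"])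
  fix v
  show "id_tensor_coprod \<Delta> (covered_E d) * id_tensor_coprod \<Delta> v =
      ((covered_value \<otimes>\<^sub>m 1) \<otimes>\<^sub>m 1) * leg12 E * leg23 (\<Delta> d) * id_tensor_coprod \<Delta> v"
  proof (induction v rule: tensor_induct)
    case (tensor r s)
    have "leg23 E * leg23 (\<Delta> d) = leg23 (\<Delta> d)" by (simp add: leg23_mult[symmetric] E_coprod_left)
    then have "leg12 E * leg23 E * id_tensor_coprod \<Delta> (r \<otimes>\<^sub>t (d * s)) =
        leg12 E * leg23 (\<Delta> d) * id_tensor_coprod \<Delta> (r \<otimes>\<^sub>t s)"
      by (metis d mult.assoc)
    then show ?case
      by (simp add: id_tensor_coprod_mult[symmetric] covered_E_mult act_value id_tensor_coprod_E[symmetric] mult.assoc)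
  qed (simp add: clinear_add[OF clinear_id_tensor_coprod] distrib_left)
qed

text \<open>
  Both sides are \<open>(b y\<^sub>h \<otimes> 1 \<otimes> 1)(E \<otimes> 1)(1 \<otimes> \<Delta>(d)(1 \<otimes> c))\<close>: the left one by
  \<open>id_tensor_coprod_covered_E\<close>, the right one because \<open>covered_E\<close> is applied to the first leg of
  \<open>\<Delta>(d)(1 \<otimes> c)\<close>.
\<close>

lemma coprod_covered_E: "tensor_map (\<lambda>x. x) (\<lambda>x. T1 \<Delta> (x \<otimes>\<^sub>t c)) (covered_E d) = tassoc (tensor_map covered_E (\<lambda>y. y) (T1 \<Delta> (d \<otimes>\<^sub>t c)))"
proof -
  have "tassoc' (tensor_map (\<lambda>x. x) (\<lambda>x. T1 \<Delta> (x \<otimes>\<^sub>t c)) (covered_E d)) = tensor_map covered_E (\<lambda>y. y) (T1 \<Delta> (d \<otimes>\<^sub>t c))"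
    (is "?l = ?r")
  proof (rule nondegenerate_left[OF nondegenerate_cube])
    \<comment> \<open>Cover the first two legs on the right; this gives access to the multipliers of \<open>id_tensor_coprod_covered_E\<close>.\<close>
    have act: "mright ((to_M r \<otimes>\<^sub>m to_M s) \<otimes>\<^sub>m 1) ?l = mright ((to_M r \<otimes>\<^sub>m to_M s) \<otimes>\<^sub>m 1) ?r" for r s
    proof -
      have T: "mleft (\<Delta> x) (s \<otimes>\<^sub>t c) = mright (to_M s \<otimes>\<^sub>m 1) (T1 \<Delta> (x \<otimes>\<^sub>t c))" for x
        by (rule to_M_sq_eqD) (simp add: mult_to_M[symmetric] to_M_times[symmetric] to_M_T1 mult.assoc mtensor_mult to_M_tensor)
      have "mright ((to_M r \<otimes>\<^sub>m to_M s) \<otimes>\<^sub>m 1) (tassoc' (tensor_map (\<lambda>x. x) (\<lambda>x. T1 \<Delta> (x \<otimes>\<^sub>t c)) z)) =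
          mleft (id_tensor_coprod \<Delta> z) ((r \<otimes>\<^sub>t s) \<otimes>\<^sub>t c)" for z
        by (induction z rule: tensor_induct)
          (simp_all add: tensor_map_tensor tensor_map_add clinear_id clinear_T1_left tassoc'_add tassoc'_act_first_two
            id_tensor_coprod_tensor clinear_add[OF clinear_id_tensor_coprod] mtensor_tassoc' T)
      then have "mright ((to_M r \<otimes>\<^sub>m to_M s) \<otimes>\<^sub>m 1) ?l =
          mleft ((covered_value \<otimes>\<^sub>m 1) \<otimes>\<^sub>m 1) (mleft (leg12 E) (tassoc' (r \<otimes>\<^sub>t mright (to_M s \<otimes>\<^sub>m 1) (T1 \<Delta> (d \<otimes>\<^sub>t c)))))"
        by (simp add: id_tensor_coprod_covered_E T)
      moreover have "mleft ((covered_value \<otimes>\<^sub>m 1) \<otimes>\<^sub>m 1) (mleft (leg12 E) (tassoc' (r \<otimes>\<^sub>t mright (to_M s \<otimes>\<^sub>m 1) v))) =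
          mright ((to_M r \<otimes>\<^sub>m to_M s) \<otimes>\<^sub>m 1) (tensor_map covered_E (\<lambda>y. y) v)" for v
        by (induction v rule: tensor_induct)
          (simp_all add: tensor_map_tensor tensor_map_add clinear_id clinear_covered_E tassoc'_tensor tassoc'_add leg12_def
            tensor_simps covered_E_mult to_M_tensor[symmetric])
      ultimately show ?thesis by simp
    qed
    fix v show "?l * v = ?r * v"
    proof (induction v rule: tensor3_induct)
      case (tensor r s y)
      have "t * ((r \<otimes>\<^sub>t s) \<otimes>\<^sub>t y) = mright (1 \<otimes>\<^sub>m to_M y) (mright ((to_M r \<otimes>\<^sub>m to_M s) \<otimes>\<^sub>m 1) t)"
        for t :: "('a \<otimes> 'a) \<otimes> 'a"
      proof -
        have "t * ((r \<otimes>\<^sub>t s) \<otimes>\<^sub>t y) = mright (to_M ((r \<otimes>\<^sub>t s) \<otimes>\<^sub>t y)) t" by simp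
        also have "to_M ((r \<otimes>\<^sub>t s) \<otimes>\<^sub>t y) = ((to_M r \<otimes>\<^sub>m to_M s) \<otimes>\<^sub>m 1) * (1 \<otimes>\<^sub>m to_M y)"
          by (simp add: mtensor_mult to_M_tensor)
        finally show ?thesis by simp
      qed
      then show ?case by (simp add: act)
    qed (simp add: distrib_left)
  qed
  then show ?thesis by (metis tassoc_tassoc')
qed

text \<open>
  Apply \<open>\<omega>\<close> to the first leg of \<open>coprod_covered_E\<close>: since \<open>(\<omega> \<otimes> id)(covered_E d) = y\<^sub>a d\<close> for
  \<open>a = (\<omega> \<otimes> id)((b \<otimes> 1)\<Delta>(h))\<close>, this is \<open>\<Delta>(y\<^sub>a d)(1 \<otimes> c) = (y\<^sub>a \<otimes> 1)\<Delta>(d)(1 \<otimes> c)\<close>.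
\<close>

lemma coprod_slice_of_slice_in_target:
  assumes \<omega>: "clinear \<omega>"
  shows "coprod_slice \<Delta> \<phi> (slice1 \<omega> (T2 \<Delta> (b \<otimes>\<^sub>t h))) \<in> target_algebra \<Delta> E"
  unfolding in_target_algebra_iff
proof
  fix d
  let ?X = "coprod_slice \<Delta> \<phi> (slice1 \<omega> (T2 \<Delta> (b \<otimes>\<^sub>t h)))"
  have X: "slice1 \<omega> (covered_E d) = mleft ?X d" for d
    unfolding covered_E_def by (rule slice1_tensor_map[OF \<omega> clinear_coprod_slice_act[OF \<phi>]])
  show "(?X \<otimes>\<^sub>m 1) * \<Delta> d = \<Delta> (mleft ?X d)"
  proof (rule cancel_right_cover)
    fix c
    have "T1 \<Delta> (mleft ?X d \<otimes>\<^sub>t c) = slice1 \<omega> (tassoc (tensor_map covered_E (\<lambda>y. y) (T1 \<Delta> (d \<otimes>\<^sub>t c))))"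
      unfolding coprod_covered_E[symmetric] slice1_tensor_map[OF \<omega> clinear_T1_left] X ..
    also have "\<dots> = mleft (?X \<otimes>\<^sub>m 1) (T1 \<Delta> (d \<otimes>\<^sub>t c))"
    proof -
      have "slice1 \<omega> (tassoc (tensor_map covered_E (\<lambda>y. y) v)) = mleft (?X \<otimes>\<^sub>m 1) v" for v
        by (induction v rule: tensor_induct)
          (simp_all add: tensor_map_tensor tensor_map_add clinear_id clinear_covered_E tassoc_add slice1_tassoc \<omega> X
            clinear_add[OF clinear_slice1[OF \<omega>]])
      then show ?thesis .
    qed
    finally show "(?X \<otimes>\<^sub>m 1) * \<Delta> d * (1 \<otimes>\<^sub>m to_M c) = \<Delta> (mleft ?X d) * (1 \<otimes>\<^sub>m to_M c)"
      by (simp add: mult.assoc to_M_T1[symmetric] mult_to_M)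
  qed
qed

end

text \<open>
  The right leg is the smallest subspace \<open>W\<close> with \<open>(A \<otimes> 1)\<Delta>(X) \<subseteq> A \<otimes> W\<close>, so it is contained in the
  subspace of all \<open>a\<close> with \<open>(id \<otimes> \<phi>)\<Delta>(a) \<in> A\<^sub>t\<close> as soon as that subspace contains the slices of
  \<open>(b \<otimes> 1)\<Delta>(x)\<close>.
\<close>

lemma slices_in_target_of_right_leg:
  assumes \<phi>: "clinear \<phi>" and leg: "right_leg \<Delta> X = UNIV"
    and X: "\<And>x. x \<in> X \<Longrightarrow> coprod_slice \<Delta> \<phi> x \<in> target_algebra \<Delta> E"
  shows "coprod_slice \<Delta> \<phi> a \<in> target_algebra \<Delta> E"
proof -
  define W where "W = {a. coprod_slice \<Delta> \<phi> a \<in> target_algebra \<Delta> E}"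
  note lin = clinear_coprod_slice[OF \<phi>]
  have "cvec.subspace W"
    unfolding cvec.subspace_def W_def mem_Collect_eq in_target_algebra_iff
    by (simp add: clinear_zero[OF lin] clinear_add[OF lin] clinear_scale[OF lin] mtensor_simps distrib_right
        mult_scaleC_left clinear_add[OF coprod_linear] clinear_scale[OF coprod_linear] clinear_zero[OF coprod_linear]
        clinear_zero[OF cbilinear_mtensor[unfolded cbilinear_def, THEN conjunct1, rule_format]])
  moreover have "(to_M b \<otimes>\<^sub>m 1) * \<Delta> x \<in> to_M ` tensor_of_sets UNIV W" if "x \<in> X" for b x
  proof -
    have "T2 \<Delta> (b \<otimes>\<^sub>t x) \<in> tensor_of_sets UNIV W"
      by (rule in_tensor_of_sets_slice1)
        (simp add: W_def coprod_slice_of_slice_in_target[OF \<phi> X[OF that]])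
    then show ?thesis unfolding to_M_T2[symmetric] by (rule imageI)
  qed
  ultimately have "right_leg \<Delta> X \<subseteq> W"
    unfolding right_leg_def by (intro Inter_lower) simp
  then show ?thesis using leg by (auto simp: W_def)
qed

end

theorem proposition3p17:
  fixes \<Delta> :: "'a::complex_alg \<Rightarrow> ('a \<otimes> 'a) multiplier"
    and \<epsilon> :: "'a \<Rightarrow> complex"
    and E :: "('a \<otimes> 'a) multiplier"
    and G1 G2 :: "'a \<otimes> 'a \<Rightarrow> 'a \<otimes> 'a"
    and S :: "'a \<Rightarrow> 'a multiplier"
    and H :: "'a set"
    and \<phi> :: "'a \<Rightarrow> complex"
  assumes "regular_weak_multiplier_Hopf_algebra \<Delta> \<epsilon> E G1 G2 S"
    and "discrete_type \<Delta> S"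
    and "H = left_cointegrals \<Delta> S"
    and "clinear \<phi>" and "\<phi> \<noteq> (\<lambda>_. 0)"
  shows "left_integral \<Delta> E \<phi> \<longleftrightarrow> (\<forall>h\<in>H. coprod_slice \<Delta> \<phi> h \<in> target_algebra \<Delta> E)"
proof -
  interpret regular_weak_multiplier_Hopf_algebra \<Delta> \<epsilon> E G1 G2 S by fact
  have "right_leg \<Delta> H = UNIV"
    using assms(2,3) by (simp add: discrete_type_def)
  then show ?thesis
    using assms(4,5) slices_in_target_of_right_leg[of \<phi> H] by (auto simp: left_integral_def)
qed

end
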